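(* Let $\alpha\in(0,2)$. There exists $C>0$ such that for all $u\in\mathcal{S}(\mathbb{R})$, all $A>1$ and $j\in\{1,2\}$, $$\left|\int|D|^\alpha\left(u\Phi_{j,A}\right)\left((|D|^\alpha u)\Phi_{j,A}\right)-\int\left(|D|^\alpha u\right)^2\Phi_{j,A}^2\right|\leq\frac{C}{A^{\frac\alpha2}}\int\left(u^2+\left(|D|^{\frac\alpha2}u\right)^2+\left(|D|^\alpha u\right)^2\right)\Phi_{j,A}^2.$$
   Context: $|D|^s$ is the Fourier multiplier with symbol $|\xi|^s$; $\langle s\rangle=(1+s^2)^{1/2}$. Let $$\phi(y)=\left(\int_{-\infty}^{+\infty}\frac{ds}{\langle s\rangle^{1+\alpha}}\right)^{-1}\int_y^{+\infty}\frac{ds}{\langle s\rangle^{1+\alpha}}.$$ For real numbers $\mu_1,\mu_2>-1$ (in the paper, the values at a fixed time of the modulation parameters, which are small), set $$\phi_1(y)=\frac{1-\phi(y)}{(1+\mu_1)^2}+\frac{\phi(y)}{(1+\mu_2)^2},\qquad \phi_2(y)=\frac{\mu_1}{(1+\mu_1)^2}(1-\phi(y))+\frac{\mu_2}{(1+\mu_2)^2}\phi(y),$$ $\Phi_j(y)=\sqrt{|\phi_j'(y)|}$ and $\Phi_{j,A}(y)=\Phi_j(y/A)$. The constant $C$ depends only on $\alpha$. *)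

theory Defs
  imports "HOL-Analysis.Analysis"
begin

definition schwartz :: "(real \<Rightarrow> real) \<Rightarrow> bool" where
  "schwartz u \<longleftrightarrow>
     (\<forall>n x. (deriv ^^ n) u field_differentiable (at x)) \<and>
     (\<forall>k n. bounded (range (\<lambda>x. x ^ k * (deriv ^^ n) u x)))"

definition fourier :: "(real \<Rightarrow> complex) \<Rightarrow> real \<Rightarrow> complex" where
  "fourier f \<xi> = (LINT x|lborel. exp (- \<i> * of_real (x * \<xi>)) * f x)"

definition fourier_multiplier ::
    "(real \<Rightarrow> complex) \<Rightarrow> (real \<Rightarrow> complex) \<Rightarrow> real \<Rightarrow> complex" where
  "fourier_multiplier m f x =
     1 / (2 * of_real pi) *
       (LINT \<xi>|lborel. exp (\<i> * of_real (x * \<xi>)) * m \<xi> * fourier f \<xi>)"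

text \<open>The operator \<open>|D|\<^sup>s\<close> on real functions. Its symbol is real and even, so the multiplier
  is real-valued on real functions (\<open>of_real_abs_D\<close> below) and \<open>Re\<close> discards nothing.\<close>

definition abs_D :: "real \<Rightarrow> (real \<Rightarrow> real) \<Rightarrow> real \<Rightarrow> real" where
  "abs_D s f x =
     Re (fourier_multiplier (\<lambda>\<xi>. of_real (\<bar>\<xi>\<bar> powr s)) (\<lambda>y. of_real (f y)) x)"

lemma fourier_cnj: "cnj (fourier (\<lambda>y. of_real (f y)) \<xi>) = fourier (\<lambda>y. of_real (f y)) (- \<xi>)"
  unfolding fourier_def by (simp add: exp_cnj flip: Bochner_Integration.integral_cnj)

lemma of_real_abs_D:
  "complex_of_real (abs_D s f x) =
     fourier_multiplier (\<lambda>\<xi>. of_real (\<bar>\<xi>\<bar> powr s)) (\<lambda>y. of_real (f y)) x"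
proof -
  let ?F = "fourier (\<lambda>y. of_real (f y))"
  let ?g = "\<lambda>\<xi>. exp (\<i> * of_real (x * \<xi>)) * of_real (\<bar>\<xi>\<bar> powr s) * ?F \<xi>"
  have "cnj (LINT \<xi>|lborel. ?g \<xi>) = (LINT \<xi>|lborel. cnj (?g \<xi>))"
    by (simp only: Bochner_Integration.integral_cnj)
  also have "\<dots> = (LINT \<xi>|lborel. ?g (- \<xi>))"
    by (simp add: exp_cnj fourier_cnj)
  also have "\<dots> = (LINT \<xi>|lborel. ?g \<xi>)"
    using lborel_integral_real_affine[of "- 1" ?g 0] by simp
  finally have "cnj (fourier_multiplier (\<lambda>\<xi>. of_real (\<bar>\<xi>\<bar> powr s)) (\<lambda>y. of_real (f y)) x) =
      fourier_multiplier (\<lambda>\<xi>. of_real (\<bar>\<xi>\<bar> powr s)) (\<lambda>y. of_real (f y)) x"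
    unfolding fourier_multiplier_def by simp
  then show ?thesis
    unfolding abs_D_def by (simp add: complex_eq_iff)
qed

definition japanese_bracket :: "real \<Rightarrow> real" where
  "japanese_bracket s = (1 + s\<^sup>2) powr (1 / 2)"

definition phi :: "real \<Rightarrow> real \<Rightarrow> real" where
  "phi \<alpha> y =
     inverse (LINT s|lborel. 1 / japanese_bracket s powr (1 + \<alpha>)) *
       (LINT s:{y..}|lborel. 1 / japanese_bracket s powr (1 + \<alpha>))"

definition phi1 :: "real \<Rightarrow> real \<Rightarrow> real \<Rightarrow> real \<Rightarrow> real" where
  "phi1 \<alpha> \<mu>1 \<mu>2 y = (1 - phi \<alpha> y) / (1 + \<mu>1)\<^sup>2 + phi \<alpha> y / (1 + \<mu>2)\<^sup>2"

definition phi2 :: "real \<Rightarrow> real \<Rightarrow> real \<Rightarrow> real \<Rightarrow> real" where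
  "phi2 \<alpha> \<mu>1 \<mu>2 y =
     \<mu>1 / (1 + \<mu>1)\<^sup>2 * (1 - phi \<alpha> y) + \<mu>2 / (1 + \<mu>2)\<^sup>2 * phi \<alpha> y"

definition Phi :: "real \<Rightarrow> real \<Rightarrow> real \<Rightarrow> nat \<Rightarrow> real \<Rightarrow> real" where
  "Phi \<alpha> \<mu>1 \<mu>2 j y =
     sqrt \<bar>deriv (if j = 1 then phi1 \<alpha> \<mu>1 \<mu>2 else phi2 \<alpha> \<mu>1 \<mu>2) y\<bar>"

definition PhiA :: "real \<Rightarrow> real \<Rightarrow> real \<Rightarrow> nat \<Rightarrow> real \<Rightarrow> real \<Rightarrow> real" where
  "PhiA \<alpha> \<mu>1 \<mu>2 j A y = Phi \<alpha> \<mu>1 \<mu>2 j (y / A)"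

end

theory Submission
  imports Defs "HOL-Probability.Probability" "HOL-Real_Asymp.Real_Asymp"
begin

text \<open>Each \<open>\<phi>\<^sub>j\<close> is an affine function of \<open>\<phi>\<close>, so \<open>\<Phi>\<^sub>j\<close> is a constant \<open>c\<close> times the weight
\<open>w(y) = (1 + y\<^sup>2) powr (- (1 + \<alpha>) / 4)\<close> (\<open>PhiA_weight\<close>). Both sides of the inequality are
multiplied by \<open>c\<^sup>2\<close>, hence \<open>c\<close>, and with it \<open>\<mu>\<^sub>1, \<mu>\<^sub>2\<close>, drops out: it is enough to treat
\<open>W(x) = w(x/A)\<close>, with a constant that depends on \<open>\<alpha>\<close> only.

Up to a positive factor, \<open>|D|\<^sup>\<alpha>\<close> is the operator
\<open>L f(x) = \<integral> (2 f(x) - f(x + h) - f(x - h)) |h| powr (-1 - \<alpha>) dh\<close> 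
(\<open>abs_D_eq_singular_frac\<close>, by Fourier inversion and Fubini). For products it satisfies
\<open>L(f g) = f L g + g L f - 2 \<Gamma>(f, g)\<close>, where \<open>\<Gamma>\<close> is the carre du champ (\<open>singular_frac_mult\<close>), so the
commutator is \<open>L(u W) - W L u = u L W - 2 \<Gamma>(u, W)\<close>.

The weight enters through two estimates, \<open>|L w| \<le> C w\<close> and \<open>\<Gamma>(w, w) \<le> C w\<^sup>2\<close>
(\<open>weight_singular_frac_bound\<close>, \<open>weight_carre_bound\<close>). They hold because \<open>w\<^sup>2\<close> is integrable and decays
exactly as fast as the kernel. By homogeneity \<open>L W\<close> and \<open>\<Gamma>(W, W)\<close> gain the factor
\<open>A powr (-\<alpha>)\<close>. Since \<open>\<Gamma>(u, W)\<close> is controlled by the geometric mean of \<open>\<Gamma>(u, u)\<close> and \<open>\<Gamma>(W, W)\<close>, only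
half of this gain survives there, which is the factor \<open>A powr (-\<alpha>/2)\<close> of the theorem
(\<open>commutator_pointwise_bound\<close>).

This leaves \<open>\<integral> \<Gamma>(u, u) W\<^sup>2\<close>. As \<open>2 \<Gamma>(u, u) = 2 u L u - L(u\<^sup>2)\<close> and \<open>L\<close> is symmetric, the last
contribution is \<open>\<integral> u\<^sup>2 L(W\<^sup>2)\<close>, and \<open>L(W\<^sup>2) = 2 W L W - 2 \<Gamma>(W, W)\<close> is again bounded by a multiple of
\<open>W\<^sup>2\<close> (\<open>carre_energy_bound\<close>). The integrals converge because \<open>W\<^sup>2\<close> is integrable and the functions
\<open>u\<close>, \<open>|D|\<^sup>s u\<close> and \<open>\<Gamma>(u, u)\<close> are bounded.\<close>

section \<open>Functions whose first derivatives are dominated by a weight\<close>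

text \<open>Two weights \<open>v\<close> occur: \<open>1\<close>, for functions with bounded derivatives, and \<open>1/(1 + x\<^sup>2)\<close>, which makes the
function and its derivatives integrable. The recursion asks for some derivative instead of iterating
\<open>deriv\<close>, so that closure properties follow by induction on \<open>n\<close> from the usual rules of differentiation.\<close>

primrec derivs_within :: "(real \<Rightarrow> real) \<Rightarrow> nat \<Rightarrow> (real \<Rightarrow> real) \<Rightarrow> bool" where
  "derivs_within v 0 f \<longleftrightarrow> continuous_on UNIV f \<and> (\<exists>C. \<forall>x. \<bar>f x\<bar> \<le> C * v x)"
| "derivs_within v (Suc n) f \<longleftrightarrow> (\<exists>C. \<forall>x. \<bar>f x\<bar> \<le> C * v x) \<and>
     (\<exists>f'. (\<forall>x. (f has_real_derivative f' x) (at x)) \<and> derivs_within v n f')"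

lemma derivs_within_bound: "derivs_within v n f \<Longrightarrow> \<exists>C. \<forall>x. \<bar>f x\<bar> \<le> C * v x"
  by (cases n) auto

lemma derivs_within_continuous: "derivs_within v n f \<Longrightarrow> continuous_on UNIV f"
  by (cases n) (auto intro!: continuous_at_imp_continuous_on intro: DERIV_isCont)

lemma derivs_within_Suc: "derivs_within v (Suc n) f \<Longrightarrow> derivs_within v n f"
proof (induction n arbitrary: f)
  case 0
  then show ?case using derivs_within_continuous[OF 0] by auto
next
  case (Suc n)
  then show ?case by (metis derivs_within.simps(2))
qed

lemma derivs_within_mono:
  "derivs_within v n f \<Longrightarrow> m \<le> n \<Longrightarrow> derivs_within v m f"
  by (induction n) (auto simp: le_Suc_eq dest: derivs_within_Suc simp del: derivs_within.simps(2))

lemma derivs_within_unweighted: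
  "derivs_within (\<lambda>x. inverse (1 + x\<^sup>2)) n f \<Longrightarrow> derivs_within (\<lambda>_. 1) n f"
proof (induction n arbitrary: f)
  have *: "\<exists>C. \<forall>x. \<bar>f x\<bar> \<le> C * 1"
    if f: "\<exists>C. \<forall>x. \<bar>f x\<bar> \<le> C * inverse (1 + x\<^sup>2)" for f :: "real \<Rightarrow> real"
  proof -
    obtain C where C: "\<And>x. \<bar>f x\<bar> \<le> C * inverse (1 + x\<^sup>2)" using f by blast
    have "C * inverse (1 + x\<^sup>2) \<le> \<bar>C\<bar> * 1" for x :: real
      by (intro mult_mono) (auto simp: inverse_le_1_iff add_pos_nonneg)
    then show ?thesis using C by (meson order_trans)
  qed
  {
    case 0
    then show ?case using *[of f] by simp
  next
    case (Suc n)
    then obtain f' where "\<forall>x. (f has_real_derivative f' x) (at x)" "derivs_within (\<lambda>_. 1) n f'"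
      by (metis derivs_within.simps(2))
    then show ?case
      using *[OF derivs_within_bound[OF Suc.prems]] unfolding derivs_within.simps
      by (intro conjI exI[of _ f'])
  }
qed

lemma derivs_within_measurable:
  "derivs_within v n f \<Longrightarrow> f \<in> borel_measurable borel"
  by (intro borel_measurable_continuous_onI derivs_within_continuous)

lemma derivs_within_add:
  "derivs_within v n f \<Longrightarrow> derivs_within v n g \<Longrightarrow> derivs_within v n (\<lambda>x. f x + g x)"
proof (induction n arbitrary: f g)
  have *: "\<exists>C. \<forall>x. \<bar>f x + g x\<bar> \<le> C * v x"
    if f: "\<exists>C. \<forall>x. \<bar>f x\<bar> \<le> C * v x" and g: "\<exists>C. \<forall>x. \<bar>g x\<bar> \<le> C * v x" for f g
  proof -
    obtain C D where C: "\<And>x. \<bar>f x\<bar> \<le> C * v x" and D: "\<And>x. \<bar>g x\<bar> \<le> D * v x"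
      using f g by blast
    have "\<bar>f x + g x\<bar> \<le> (C + D) * v x" for x
      using C[of x] D[of x] by (simp add: distrib_right)
    then show ?thesis by blast
  qed
  {
    case 0
    have "continuous_on UNIV (\<lambda>x. f x + g x)"
      using 0 unfolding derivs_within.simps by (intro continuous_on_add) blast+
    moreover have "\<exists>C. \<forall>x. \<bar>f x + g x\<bar> \<le> C * v x"
      using 0 unfolding derivs_within.simps by (intro *) blast+
    ultimately show ?case unfolding derivs_within.simps by blast
  next
    case (Suc n)
    then obtain f' g' where "\<forall>x. (f has_real_derivative f' x) (at x)" "derivs_within v n f'"
      "\<forall>x. (g has_real_derivative g' x) (at x)" "derivs_within v n g'"
      by (metis derivs_within.simps(2))
    moreover have "\<exists>C. \<forall>x. \<bar>f x + g x\<bar> \<le> C * v x"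
      using * Suc.prems by simp
    ultimately show ?case
      unfolding derivs_within.simps using Suc.IH
      by (intro conjI exI[of _ "\<lambda>x. f' x + g' x"]) (auto intro!: derivative_eq_intros)
  }
qed

lemma derivs_within_mult:
  "derivs_within v n f \<Longrightarrow> derivs_within (\<lambda>_. 1) n g \<Longrightarrow> derivs_within v n (\<lambda>x. f x * g x)"
proof (induction n arbitrary: f g)
  have *: "\<exists>C. \<forall>x. \<bar>f x * g x\<bar> \<le> C * v x"
    if f: "\<exists>C. \<forall>x. \<bar>f x\<bar> \<le> C * v x" and g: "\<exists>C. \<forall>x. \<bar>g x\<bar> \<le> C * 1" for f g :: "real \<Rightarrow> real"
  proof -
    obtain C D where C: "\<And>x. \<bar>f x\<bar> \<le> C * v x" and D: "\<And>x. \<bar>g x\<bar> \<le> D" using f g by auto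
    have "\<bar>f x\<bar> * \<bar>g x\<bar> \<le> (C * v x) * D" for x
      using C[of x] D[of x] by (intro mult_mono) (auto intro: order_trans[OF abs_ge_zero])
    then have "\<bar>f x * g x\<bar> \<le> (C * D) * v x" for x
      by (simp add: abs_mult mult_ac)
    then show ?thesis by blast
  qed
  {
    case 0
    have "continuous_on UNIV (\<lambda>x. f x * g x)"
      using 0 unfolding derivs_within.simps by (intro continuous_on_mult) blast+
    moreover have "\<exists>C. \<forall>x. \<bar>f x * g x\<bar> \<le> C * v x"
      using 0 unfolding derivs_within.simps by (intro *) blast+
    ultimately show ?case unfolding derivs_within.simps by blast
  next
    case (Suc n)
    then obtain f' g' where "\<forall>x. (f has_real_derivative f' x) (at x)" "derivs_within v n f'"
      "\<forall>x. (g has_real_derivative g' x) (at x)" "derivs_within (\<lambda>_. 1) n g'"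
      by (metis derivs_within.simps(2))
    moreover have "\<exists>C. \<forall>x. \<bar>f x * g x\<bar> \<le> C * v x"
      using Suc.prems unfolding derivs_within.simps by (intro *) blast+
    moreover have "derivs_within v n f" "derivs_within (\<lambda>_. 1) n g"
      using Suc.prems derivs_within_Suc by blast+
    ultimately show ?case
      unfolding derivs_within.simps using Suc.IH
      by (intro conjI exI[of _ "\<lambda>x. f' x * g x + f x * g' x"])
        (auto intro!: derivative_eq_intros derivs_within_add)
  }
qed

lemma derivs_within_const: "derivs_within (\<lambda>_. 1) n (\<lambda>_. c)"
  by (induction n arbitrary: c) (auto intro!: exI[of _ "\<lambda>_. 0"] derivative_eq_intros)

lemma derivs_within_cmult: "derivs_within v n f \<Longrightarrow> derivs_within v n (\<lambda>x. c * f x)"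
  using derivs_within_mult[OF _ derivs_within_const, of v n f c] by (simp add: mult.commute)

lemma derivs_within_dilate:
  assumes A: "A \<noteq> 0"
  shows "derivs_within (\<lambda>_. 1) n f \<Longrightarrow> derivs_within (\<lambda>_. 1) n (\<lambda>x. f (x / A))"
proof (induction n arbitrary: f)
  case 0
  then show ?case
    using continuous_on_compose2[of UNIV f UNIV "\<lambda>x. x / A"]
    by (auto simp: divide_inverse continuous_on_mult_right)
next
  case (Suc n)
  then obtain f' where f': "\<forall>x. (f has_real_derivative f' x) (at x)" "derivs_within (\<lambda>_. 1) n f'"
    by (metis derivs_within.simps(2))
  have "((\<lambda>x. x / A) has_real_derivative 1 / A) (at x)" for x
    using A by (auto intro!: derivative_eq_intros)
  then have "((\<lambda>x. f (x / A)) has_real_derivative (1 / A) * f' (x / A)) (at x)" for x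
    using DERIV_chain2[of f "f' (x / A)" "\<lambda>x. x / A" x "1 / A" UNIV] f'(1) by simp
  moreover have "derivs_within (\<lambda>_. 1) n (\<lambda>x. (1 / A) * f' (x / A))"
    using Suc.IH[OF f'(2)] by (rule derivs_within_cmult)
  moreover have "\<exists>C. \<forall>x. \<bar>f (x / A)\<bar> \<le> C * 1" using Suc.prems by auto
  ultimately show ?case
    unfolding derivs_within.simps by (intro conjI exI[of _ "\<lambda>x. (1 / A) * f' (x / A)"] allI)
qed

lemma abs_power_le_bracket: "\<bar>x::real\<bar> ^ k \<le> (1 + x\<^sup>2) powr (real k / 2)"
proof -
  have "\<bar>x\<bar> ^ k \<le> sqrt (1 + x\<^sup>2) ^ k"
    by (intro power_mono) (auto intro!: real_le_rsqrt)
  also have "\<dots> = (1 + x\<^sup>2) powr (real k / 2)"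
    using powr_realpow[of "(1 + x\<^sup>2) powr (1 / 2)" k] add_pos_nonneg[of 1 "x\<^sup>2"]
    by (simp add: powr_half_sqrt[symmetric] powr_powr)
  finally show ?thesis .
qed

text \<open>The order of growth of \<open>x ^ k * (1 + x\<^sup>2) powr p\<close> is \<open>k + 2 p\<close>. Its derivative is a combination of two
functions of the same family of smaller order, so the induction has to run over all \<open>k\<close> and \<open>p\<close> at once.\<close>

lemma derivs_within_power_bracket:
  "real k + 2 * p \<le> 0 \<Longrightarrow> derivs_within (\<lambda>_. 1) n (\<lambda>x. x ^ k * (1 + x\<^sup>2) powr p)"
proof (induction n arbitrary: k p)
  have *: "\<bar>x ^ k * (1 + x\<^sup>2) powr p\<bar> \<le> 1" if "real k + 2 * p \<le> 0" for k p and x :: real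
  proof -
    have "\<bar>x ^ k * (1 + x\<^sup>2) powr p\<bar> = \<bar>x\<bar> ^ k * (1 + x\<^sup>2) powr p"
      by (simp add: abs_mult power_abs)
    also have "\<dots> \<le> (1 + x\<^sup>2) powr (real k / 2) * (1 + x\<^sup>2) powr p"
      by (intro mult_right_mono abs_power_le_bracket) auto
    also have "\<dots> = (1 + x\<^sup>2) powr (real k / 2 + p)"
      by (simp add: powr_add)
    also have "\<dots> \<le> 1"
      using that powr_mono[of "real k / 2 + p" 0 "1 + x\<^sup>2"] by (auto split: if_splits)
    finally show ?thesis .
  qed
  have pos: "1 + x\<^sup>2 > 0" for x :: real by (simp add: add_pos_nonneg)
  {
    case 0
    have "1 + x\<^sup>2 \<noteq> 0" for x :: real using pos[of x] by simp
    then have "continuous_on UNIV (\<lambda>x::real. x ^ k * (1 + x\<^sup>2) powr p)"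
      by (intro continuous_intros ballI)
    then show ?case using *[OF 0] by auto
  next
    case (Suc n)
    let ?g = "\<lambda>x::real. real k * (x ^ (k - 1) * (1 + x\<^sup>2) powr p)
        + (2 * p) * (x ^ (k + 1) * (1 + x\<^sup>2) powr (p - 1))"
    have "((\<lambda>x. x ^ k * (1 + x\<^sup>2) powr p) has_real_derivative ?g x) (at x)" for x
      using pos[of x]
      by (auto intro!: derivative_eq_intros simp: powr_diff field_simps)
    moreover have "derivs_within (\<lambda>_. 1) n ?g"
    proof (intro derivs_within_add derivs_within_cmult Suc.IH)
      show "real (k + 1) + 2 * (p - 1) \<le> 0" "real (k - 1) + 2 * p \<le> 0"
        using Suc.prems by auto
    qed
    ultimately show ?case
      unfolding derivs_within.simps using *[OF Suc.prems]
      by (intro conjI exI[of _ ?g] exI[of _ 1] allI) simp_all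
  }
qed

lemma schwartz_derivs_within:
  assumes "schwartz u"
  shows "derivs_within (\<lambda>x. inverse (1 + x\<^sup>2)) n ((deriv ^^ k) u)"
proof (induction n arbitrary: k)
  have *: "\<exists>C. \<forall>x. \<bar>(deriv ^^ k) u x\<bar> \<le> C * inverse (1 + x\<^sup>2)" for k
  proof -
    have b: "\<exists>C. \<forall>x. \<bar>x ^ i * (deriv ^^ k) u x\<bar> \<le> C" for i
      using assms unfolding schwartz_def bounded_iff by auto
    obtain C D where C: "\<And>x. \<bar>(deriv ^^ k) u x\<bar> \<le> C" and D: "\<And>x. \<bar>x\<^sup>2 * (deriv ^^ k) u x\<bar> \<le> D"
      using b[of 0] b[of 2] by auto
    have "\<bar>(deriv ^^ k) u x\<bar> \<le> (C + D) * inverse (1 + x\<^sup>2)" for x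
    proof -
      have "\<bar>(deriv ^^ k) u x\<bar> * (1 + x\<^sup>2) \<le> C + D"
        using C[of x] D[of x] by (simp add: abs_mult algebra_simps)
      then show ?thesis by (simp add: field_simps add_pos_nonneg)
    qed
    then show ?thesis by blast
  qed
  have d: "((deriv ^^ k) u has_real_derivative (deriv ^^ Suc k) u x) (at x)" for k x
    using assms unfolding schwartz_def by (simp add: field_differentiable_derivI)
  {
    case 0
    have "continuous_on UNIV ((deriv ^^ k) u)"
      using DERIV_isCont[OF d] by (intro continuous_at_imp_continuous_on ballI)
    then show ?case using * by simp
  next
    case (Suc n)
    then show ?case using * d[of k] Suc[of "Suc k"] unfolding derivs_within.simps by blast
  }
qed

section \<open>The Fourier transform: decay and inversion\<close>

lemma integrable_inverse_square: "integrable lborel (\<lambda>x::real. inverse (1 + x^2))"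
  using integrable_inverse_1_plus_square by (simp add: set_integrable_def)

lemma derivs_within_integrable:
  assumes "derivs_within (\<lambda>x. inverse (1 + x\<^sup>2)) n f"
  shows "integrable lborel f"
proof -
  obtain C where C: "\<And>x. \<bar>f x\<bar> \<le> C * inverse (1 + x\<^sup>2)"
    using derivs_within_bound[OF assms] by blast
  note [measurable] = derivs_within_measurable[OF assms]
  show ?thesis
    by (rule Bochner_Integration.integrable_bound[OF integrable_mult_right[OF integrable_inverse_square, of C]])
      (use C in \<open>auto intro!: AE_I2 intro: order_trans[OF _ abs_ge_self]\<close>)
qed

lemma integrable_fourier_integrand:
  assumes "integrable lborel f"
  shows "integrable lborel (\<lambda>x. exp (- \<i> * of_real (x * \<xi>)) * complex_of_real (f x))"
proof (rule Bochner_Integration.integrable_bound[OF assms])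
  have [measurable]: "f \<in> borel_measurable lborel" using assms by auto
  show "(\<lambda>x. exp (- \<i> * of_real (x * \<xi>)) * complex_of_real (f x)) \<in> borel_measurable lborel"
    by measurable
qed (simp add: norm_mult)

lemma norm_fourier_le:
  "integrable lborel f \<Longrightarrow> cmod (fourier (\<lambda>y. of_real (f y)) \<xi>) \<le> (LINT x|lborel. \<bar>f x\<bar>)"
  unfolding fourier_def
  by (rule order_trans[OF integral_norm_bound]) (simp add: norm_mult)

text \<open>Integration by parts; the boundary terms vanish because \<open>f\<close> tends to \<open>0\<close> at both ends.\<close>

lemma fourier_deriv:
  assumes f: "derivs_within (\<lambda>x. inverse (1 + x\<^sup>2)) 0 f"
    and f': "derivs_within (\<lambda>x. inverse (1 + x\<^sup>2)) 0 f'"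
    and d: "\<And>x. (f has_real_derivative f' x) (at x)"
  shows "fourier (\<lambda>y. of_real (f' y)) \<xi> = \<i> * of_real \<xi> * fourier (\<lambda>y. of_real (f y)) \<xi>"
proof -
  let ?e = "\<lambda>x. exp (- \<i> * of_real (x * \<xi>))"
  let ?F = "\<lambda>x. ?e x * complex_of_real (f x)"
  let ?G = "\<lambda>x. ?e x * complex_of_real (f' x) - \<i> * of_real \<xi> * (?e x * complex_of_real (f x))"
  note i = integrable_fourier_integrand[OF derivs_within_integrable[OF f], of \<xi>]
    integrable_fourier_integrand[OF derivs_within_integrable[OF f'], of \<xi>]
  have cont: "continuous_on UNIV f" "continuous_on UNIV f'"
    using f f' by auto
  have lim: "(f \<longlongrightarrow> 0) F" if "((\<lambda>x. inverse (1 + x\<^sup>2)) \<longlongrightarrow> 0) F" for F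
  proof -
    obtain C where "\<And>x. \<bar>f x\<bar> \<le> C * inverse (1 + x\<^sup>2)" using f by auto
    then show ?thesis
      by (intro Lim_null_comparison[OF _ tendsto_mult_right_zero[OF that, of C]]) auto
  qed
  have lims: "(f \<longlongrightarrow> 0) at_top" "(f \<longlongrightarrow> 0) at_bot"
    by (rule lim, real_asymp)+
  have limF: "(?F \<longlongrightarrow> 0) F" if "(f \<longlongrightarrow> 0) F" for F
    by (rule Lim_null_comparison[OF _ tendsto_norm_zero[OF that]]) (simp add: norm_mult)
  have D: "(?F has_vector_derivative ?G x) (at x)" for x
  proof -
    have "((\<lambda>z. exp (- \<i> * (z * of_real \<xi>))) has_field_derivative
        exp (- \<i> * (of_real x * of_real \<xi>)) * (- \<i> * of_real \<xi>)) (at (complex_of_real x))"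
      by (auto intro!: derivative_eq_intros)
    from has_vector_derivative_real_field[OF this]
    have "(?e has_vector_derivative ?e x * (- \<i> * of_real \<xi>)) (at x)"
      by simp
    from has_vector_derivative_mult[OF this has_vector_derivative_of_real[OF d]]
    show ?thesis by (simp add: algebra_simps)
  qed
  have "(LBINT x=-\<infinity>..\<infinity>. ?G x) = 0 - 0"
  proof (rule interval_integral_FTC_integrable)
    show "(?F has_vector_derivative ?G x) (at x)" for x by (rule D)
    show "isCont ?G x" for x
      using cont by (auto intro!: continuous_intros simp: continuous_on_eq_continuous_at)
    show "set_integrable lborel (einterval (-\<infinity>) \<infinity>) ?G"
      using i by (simp add: set_integrable_def)
    show "((?F \<circ> real_of_ereal) \<longlongrightarrow> 0) (at_right (-\<infinity>))"
      using limF[OF lims(2)] by (simp add: ereal_tendsto_simps)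
    show "((?F \<circ> real_of_ereal) \<longlongrightarrow> 0) (at_left \<infinity>)"
      using limF[OF lims(1)] by (simp add: ereal_tendsto_simps)
  qed auto
  then have "(LINT x|lborel. ?G x) = 0"
    by (simp add: interval_lebesgue_integral_def set_lebesgue_integral_def)
  then show ?thesis
    unfolding fourier_def using i by simp
qed

lemma fourier_decay:
  "derivs_within (\<lambda>x. inverse (1 + x\<^sup>2)) n f \<Longrightarrow>
     \<exists>C. \<forall>\<xi>. \<bar>\<xi>\<bar> ^ n * cmod (fourier (\<lambda>y. of_real (f y)) \<xi>) \<le> C"
proof (induction n arbitrary: f)
  case 0
  then show ?case using norm_fourier_le[OF derivs_within_integrable[OF 0]] by auto
next
  case (Suc n)
  then obtain f' where f': "\<And>x. (f has_real_derivative f' x) (at x)"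
    "derivs_within (\<lambda>x. inverse (1 + x\<^sup>2)) n f'"
    by (metis derivs_within.simps(2))
  have z: "derivs_within v n g \<Longrightarrow> derivs_within v 0 g" for v g n
    using derivs_within_bound derivs_within_continuous by auto
  obtain C where C: "\<And>\<xi>. \<bar>\<xi>\<bar> ^ n * cmod (fourier (\<lambda>y. of_real (f' y)) \<xi>) \<le> C"
    using Suc.IH[OF f'(2)] by blast
  have "\<bar>\<xi>\<bar> ^ Suc n * cmod (fourier (\<lambda>y. of_real (f y)) \<xi>) \<le> C" for \<xi>
    using C[of \<xi>] fourier_deriv[OF z[OF Suc.prems] z[OF f'(2)] f'(1), of \<xi>]
    by (simp add: norm_mult mult_ac)
  then show ?case by blast
qed

text \<open>The hypothesis of Fubini's theorem, in the form in which it is met every time two integrals are exchanged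
below.\<close>

lemma integrable_pair_bound:
  fixes F :: "real \<Rightarrow> real \<Rightarrow> 'a :: {banach, second_countable_topology}"
  assumes F [measurable]: "case_prod F \<in> borel_measurable (lborel \<Otimes>\<^sub>M lborel)"
    and a: "integrable lborel a" and b: "integrable lborel b"
    and le: "\<And>x y. norm (F x y) \<le> a x * b y"
  shows "integrable (lborel \<Otimes>\<^sub>M lborel) (case_prod F)"
proof (rule Bochner_Integration.integrable_bound)
  have [measurable]: "a \<in> borel_measurable lborel" "b \<in> borel_measurable lborel"
    using a b by auto
  show "integrable (lborel \<Otimes>\<^sub>M lborel) (\<lambda>(x, y). a x * b y)"
  proof (rule lborel_pair.Fubini_integrable)
    have "integrable lborel (\<lambda>x. \<bar>a x\<bar> * (LINT y|lborel. \<bar>b y\<bar>))"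
      using a by simp
    then show "integrable lborel (\<lambda>x. LINT y|lborel. norm (case (x, y) of (x, y) \<Rightarrow> a x * b y))"
      by (simp add: abs_mult)
    show "AE x in lborel. integrable lborel (\<lambda>y. case (x, y) of (x, y) \<Rightarrow> a x * b y)"
      using b by simp
  qed measurable
  show "AE p in lborel \<Otimes>\<^sub>M lborel. norm (case_prod F p) \<le> norm (case_prod (\<lambda>x y. a x * b y) p)"
    using le by (auto intro!: AE_I2 intro: order_trans[OF _ abs_ge_self])
qed measurable

lemma fourier_measurable [measurable]:
  assumes [measurable]: "f \<in> borel_measurable borel"
  shows "fourier f \<in> borel_measurable borel"
  unfolding fourier_def[abs_def] by measurable

lemma gaussian_transform:
  "(LINT x|lborel. exp (\<i> * of_real (t * x)) * complex_of_real (std_normal_density x)) =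
     of_real (exp (- t\<^sup>2 / 2))"
proof -
  have "char std_normal_distribution t =
      (LINT x|lborel. std_normal_density x *\<^sub>R exp (\<i> * of_real (t * x)))"
    unfolding char_def by (subst integral_density) auto
  then show ?thesis
    by (simp add: char_std_normal_distribution scaleR_conv_of_real mult.commute)
qed

lemma gaussian_transform_scaled:
  assumes "e > 0"
  shows "(LINT x|lborel. exp (\<i> * of_real (t * x)) * complex_of_real (std_normal_density (e * x))) =
     of_real (exp (- (t / e)\<^sup>2 / 2) / e)"
proof -
  have "of_real (exp (- (t / e)\<^sup>2 / 2)) =
      (LINT x|lborel. exp (\<i> * of_real (t / e * x)) * complex_of_real (std_normal_density x))"
    by (rule gaussian_transform[symmetric])
  also have "\<dots> = \<bar>e\<bar> *\<^sub>R (LINT x|lborel. exp (\<i> * of_real (t / e * (0 + e * x))) *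
      complex_of_real (std_normal_density (0 + e * x)))"
    by (rule lborel_integral_real_affine) (use assms in simp)
  also have "\<dots> = of_real e * (LINT x|lborel. exp (\<i> * of_real (t * x)) *
      complex_of_real (std_normal_density (e * x)))"
    using assms by (simp add: scaleR_conv_of_real)
  finally show ?thesis
    using assms by (simp add: field_simps)
qed

text \<open>Gaussian regularization. If the factor \<open>g(e \<xi>)\<close>, with \<open>g\<close> the standard normal density, is inserted into
the inversion integral, then Fubini and the known transform of \<open>g\<close> turn the integral into a Gaussian
average of \<open>f\<close> around \<open>x\<close> at scale \<open>e\<close>. Both sides converge by dominated convergence as \<open>e\<close> tends to
\<open>0\<close>.\<close>

lemma fourier_inversion:
  fixes f :: "real \<Rightarrow> real"
  assumes f: "continuous_on UNIV f" "integrable lborel f" "\<And>x. \<bar>f x\<bar> \<le> C"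
    and F: "integrable lborel (\<lambda>\<xi>. cmod (fourier (\<lambda>y. of_real (f y)) \<xi>))"
  shows "(LINT \<xi>|lborel. exp (\<i> * of_real (x * \<xi>)) * fourier (\<lambda>y. of_real (f y)) \<xi>) =
     of_real (2 * pi * f x)"
proof -
  let ?F = "fourier (\<lambda>y. of_real (f y))"
  let ?g = "std_normal_density"
  let ?e = "\<lambda>n. inverse (real (Suc n))"
  let ?I = "\<lambda>e. LINT \<xi>|lborel. exp (\<i> * of_real (x * \<xi>)) * ?F \<xi> * of_real (?g (e * \<xi>))"
  have [measurable]: "f \<in> borel_measurable borel"
    using f(1) by (rule borel_measurable_continuous_onI)
  have e0: "?e \<longlonglongrightarrow> 0" by (rule LIMSEQ_inverse_real_of_nat)
  have gc: "isCont ?g z" for z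
    unfolding normal_density_def by (intro continuous_intros) auto
  have gb: "?g z \<le> ?g 0" for z
    by (simp add: normal_density_def divide_right_mono)
  have g0: "?g z \<ge> 0" for z by simp
  have gi: "integrable lborel (\<lambda>z. ?g (e * z))" if "e > 0" for e
    using lborel_integrable_real_affine[of ?g e 0] that by simp
  have I: "?I e = of_real (sqrt (2 * pi) * (LINT z|lborel. f (x + e * z) * ?g z))" if e: "e > 0" for e
  proof -
    let ?H = "\<lambda>\<xi> y. exp (\<i> * of_real ((x - y) * \<xi>)) * of_real (f y) * complex_of_real (?g (e * \<xi>))"
    have "?I e = (LINT \<xi>|lborel. LINT y|lborel. ?H \<xi> y)"
      unfolding fourier_def
      by (simp flip: integral_mult_right_zero integral_mult_left_zero)
        (simp add: mult_ac exp_add[symmetric] algebra_simps flip: exp_add)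
    also have "\<dots> = (LINT y|lborel. LINT \<xi>|lborel. ?H \<xi> y)"
    proof (rule lborel_pair.Fubini_integral[symmetric], rule integrable_pair_bound)
      show "norm (?H \<xi> y) \<le> ?g (e * \<xi>) * \<bar>f y\<bar>" for \<xi> y
        by (simp add: norm_mult)
    qed (use gi[OF e] f in auto)
    also have "\<dots> = (LINT y|lborel. of_real (f y) * (LINT \<xi>|lborel.
        exp (\<i> * of_real ((x - y) * \<xi>)) * complex_of_real (?g (e * \<xi>))))"
      by (simp flip: integral_mult_right_zero) (simp add: mult_ac)
    also have "\<dots> = (LINT y|lborel. complex_of_real (f y * (exp (- ((x - y) / e)\<^sup>2 / 2) / e)))"
      by (subst gaussian_transform_scaled[OF e]) simp
    also have "\<dots> = of_real (LINT y|lborel. f y * (exp (- ((x - y) / e)\<^sup>2 / 2) / e))"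
      by (rule integral_complex_of_real)
    also have "(LINT y|lborel. f y * (exp (- ((x - y) / e)\<^sup>2 / 2) / e)) =
        \<bar>e\<bar> *\<^sub>R (LINT z|lborel. f (x + e * z) * (exp (- ((x - (x + e * z)) / e)\<^sup>2 / 2) / e))"
      by (rule lborel_integral_real_affine) (use e in simp)
    also have "\<dots> = sqrt (2 * pi) * (LINT z|lborel. f (x + e * z) * ?g z)"
      using e by (simp add: std_normal_density_def flip: integral_mult_right_zero)
        (simp add: mult_ac)
    finally show ?thesis .
  qed
  have "(\<lambda>n. ?I (?e n)) \<longlonglongrightarrow> (LINT \<xi>|lborel. exp (\<i> * of_real (x * \<xi>)) * ?F \<xi> * of_real (?g 0))"
  proof (rule integral_dominated_convergence)
    show "integrable lborel (\<lambda>\<xi>. cmod (?F \<xi>) * ?g 0)" using F by simp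
    show "AE \<xi> in lborel. (\<lambda>n. exp (\<i> * of_real (x * \<xi>)) * ?F \<xi> * of_real (?g (?e n * \<xi>)))
        \<longlonglongrightarrow> exp (\<i> * of_real (x * \<xi>)) * ?F \<xi> * of_real (?g 0)"
      by (intro AE_I2 tendsto_intros isCont_tendsto_compose[OF gc]) (use e0 in \<open>auto intro: tendsto_mult_left_zero\<close>)
    show "AE \<xi> in lborel. norm (exp (\<i> * of_real (x * \<xi>)) * ?F \<xi> * of_real (?g (?e n * \<xi>)))
        \<le> cmod (?F \<xi>) * ?g 0" for n
      using gb by (intro AE_I2) (auto simp: norm_mult intro!: mult_left_mono)
  qed measurable
  moreover have "(\<lambda>n. LINT z|lborel. f (x + ?e n * z) * ?g z) \<longlonglongrightarrow> (LINT z|lborel. f x * ?g z)"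
  proof (rule integral_dominated_convergence)
    show "integrable lborel (\<lambda>z. C * ?g z)" by simp
    have "(\<lambda>n. x + ?e n * z) \<longlonglongrightarrow> x + 0 * z" for z by (intro tendsto_intros e0)
    moreover have "isCont f x" using f(1) by (simp add: continuous_on_eq_continuous_at)
    ultimately show "AE z in lborel. (\<lambda>n. f (x + ?e n * z) * ?g z) \<longlonglongrightarrow> f x * ?g z"
      by (intro AE_I2 tendsto_intros isCont_tendsto_compose[of x f]) auto
    show "AE z in lborel. norm (f (x + ?e n * z) * ?g z) \<le> C * ?g z" for n
      using f(3) by (intro AE_I2) (auto simp: abs_mult intro!: mult_right_mono)
  qed measurable
  then have "(\<lambda>n. ?I (?e n)) \<longlonglongrightarrow> of_real (sqrt (2 * pi) * f x)"
    by (subst I) (auto intro!: tendsto_intros)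
  ultimately have "(LINT \<xi>|lborel. exp (\<i> * of_real (x * \<xi>)) * ?F \<xi> * of_real (?g 0)) =
      of_real (sqrt (2 * pi) * f x)"
    by (rule LIMSEQ_unique)
  then have "(LINT \<xi>|lborel. exp (\<i> * of_real (x * \<xi>)) * ?F \<xi>) * of_real (?g 0) =
      of_real (sqrt (2 * pi) * f x)"
    by (subst (asm) integral_mult_left_zero)
  then have "(LINT \<xi>|lborel. exp (\<i> * of_real (x * \<xi>)) * ?F \<xi>) * of_real (?g 0 * sqrt (2 * pi)) =
      of_real (sqrt (2 * pi) * f x * sqrt (2 * pi))"
    unfolding of_real_mult mult.assoc[symmetric] by (rule arg_cong)
  moreover have "?g 0 * sqrt (2 * pi) = 1" "sqrt (2 * pi) * f x * sqrt (2 * pi) = 2 * pi * f x"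
    by (simp_all add: std_normal_density_def)
  ultimately show ?thesis by (simp only: of_real_1 mult_1_right)
qed

text \<open>Four derivatives bound the transform by a multiple of \<open>1/(1 + \<xi>\<^sup>2)\<^sup>2\<close>. This pays for the integrability
of every symbol \<open>|\<xi>|\<^sup>s\<close> with \<open>0 \<le> s \<le> 2\<close>.\<close>

lemma fourier_weight_integrable:
  assumes "derivs_within (\<lambda>x. inverse (1 + x\<^sup>2)) 4 f"
  shows "integrable lborel (\<lambda>\<xi>. (1 + \<xi>\<^sup>2) * cmod (fourier (\<lambda>y. of_real (f y)) \<xi>))"
proof -
  let ?F = "fourier (\<lambda>y. complex_of_real (f y))"
  note [measurable] = derivs_within_measurable[OF assms]
  have "derivs_within (\<lambda>x. inverse (1 + x\<^sup>2)) 0 f"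
    using derivs_within_bound[OF assms] derivs_within_continuous[OF assms] by auto
  then obtain C D where C: "\<And>\<xi>. cmod (?F \<xi>) \<le> C" and D: "\<And>\<xi>. \<bar>\<xi>\<bar> ^ 4 * cmod (?F \<xi>) \<le> D"
    using fourier_decay[of 0 f] fourier_decay[OF assms] by auto
  have "(1 + \<xi>\<^sup>2) * cmod (?F \<xi>) \<le> 2 * (C + D) * inverse (1 + \<xi>\<^sup>2)" for \<xi>
  proof -
    have "(1 + \<xi>\<^sup>2)\<^sup>2 * cmod (?F \<xi>) \<le> 2 * (1 + \<bar>\<xi>\<bar> ^ 4) * cmod (?F \<xi>)"
      using zero_le_power2[of "\<xi>\<^sup>2 - 1"]
      by (intro mult_right_mono) (auto simp: power2_eq_square power4_eq_xxxx algebra_simps)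
    also have "\<dots> \<le> 2 * (C + D)"
      using C[of \<xi>] D[of \<xi>] by (simp add: algebra_simps)
    finally show ?thesis
      using add_pos_nonneg[of 1 "\<xi>\<^sup>2"] by (simp add: field_simps power2_eq_square)
  qed
  then show ?thesis
    by (intro Bochner_Integration.integrable_bound[OF integrable_mult_right[OF integrable_inverse_square, of "2 * (C + D)"]])
      (auto intro!: AE_I2 intro: order_trans[OF _ abs_ge_self])
qed

section \<open>The singular integral form of the fractional derivative\<close>

text \<open>At \<open>h = 0\<close> the value is \<open>0\<close> by the convention for \<open>powr\<close>.\<close>

definition frac_kernel :: "real \<Rightarrow> real \<Rightarrow> real" where
  "frac_kernel \<alpha> h = \<bar>h\<bar> powr (- 1 - \<alpha>)"

definition second_diff :: "(real \<Rightarrow> real) \<Rightarrow> real \<Rightarrow> real \<Rightarrow> real" where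
  "second_diff f x h = 2 * f x - f (x + h) - f (x - h)"

text \<open>Integrating second differences makes the integral absolutely convergent for every \<open>\<alpha> < 2\<close>; with first
differences a principal value would be needed once \<open>\<alpha> \<ge> 1\<close>.\<close>

definition singular_frac :: "real \<Rightarrow> (real \<Rightarrow> real) \<Rightarrow> real \<Rightarrow> real" where
  "singular_frac \<alpha> f x = (LINT h|lborel. second_diff f x h * frac_kernel \<alpha> h)"

text \<open>The defect in the product rule for the singular integral operator, see \<open>singular_frac_mult\<close>.\<close>

definition carre_du_champ :: "real \<Rightarrow> (real \<Rightarrow> real) \<Rightarrow> (real \<Rightarrow> real) \<Rightarrow> real \<Rightarrow> real" where
  "carre_du_champ \<alpha> f g x = (LINT h|lborel. (f x - f (x + h)) * (g x - g (x + h)) * frac_kernel \<alpha> h)"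

text \<open>The symbol of the singular integral operator at frequency \<open>1\<close>, see \<open>symbol_scaling\<close>.\<close>

definition symbol_const :: "real \<Rightarrow> real" where
  "symbol_const \<alpha> = (LINT h|lborel. (2 - 2 * cos h) * frac_kernel \<alpha> h)"

lemma frac_kernel_nonneg [simp]: "frac_kernel \<alpha> h \<ge> 0"
  by (simp add: frac_kernel_def)

lemma frac_kernel_minus [simp]: "frac_kernel \<alpha> (- h) = frac_kernel \<alpha> h"
  by (simp add: frac_kernel_def)

lemma frac_kernel_measurable [measurable]: "frac_kernel \<alpha> \<in> borel_measurable borel"
  unfolding frac_kernel_def[abs_def] by measurable

lemma frac_kernel_scale:
  "frac_kernel \<alpha> (c * h) = \<bar>c\<bar> powr (- 1 - \<alpha>) * frac_kernel \<alpha> h"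
  by (simp add: frac_kernel_def abs_mult powr_mult)

text \<open>The function that dominates second differences, and products of two first differences, of smooth
bounded functions: \<open>\<alpha> < 2\<close> gives convergence near \<open>0\<close>, \<open>\<alpha> > 0\<close> convergence at infinity.\<close>

lemma integrable_truncated_kernel:
  assumes "0 < \<alpha>" "\<alpha> < 2"
  shows "integrable lborel (\<lambda>h. min 1 (h\<^sup>2) * frac_kernel \<alpha> h)"
proof -
  let ?m = "\<lambda>h. min 1 (h\<^sup>2) * frac_kernel \<alpha> h"
  have "(\<lambda>h::real. h powr (1 - \<alpha>)) absolutely_integrable_on {0..1}"
    using assms by (subst absolutely_integrable_on_iff_nonneg) (auto intro!: integrable_on_powr_from_0)
  then have near: "integrable lborel (\<lambda>h::real. indicator {0..1} h * h powr (1 - \<alpha>))"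
    unfolding set_integrable_def by (subst (asm) integrable_completion) auto
  have "(\<lambda>h::real. h powr (- 1 - \<alpha>)) integrable_on {1..}"
    using has_integral_powr_to_inf[of "- 1 - \<alpha>" 1] assms unfolding integrable_on_def by auto
  then have "(\<lambda>h::real. h powr (- 1 - \<alpha>)) absolutely_integrable_on {1..}"
    by (subst absolutely_integrable_on_iff_nonneg) auto
  then have far: "integrable lborel (\<lambda>h::real. indicator {1..} h * h powr (- 1 - \<alpha>))"
    unfolding set_integrable_def by (subst (asm) integrable_completion) auto
  \<comment> \<open>Half of the line suffices, since the function is even and vanishes at \<open>0\<close>.\<close>
  have half: "integrable lborel (\<lambda>h. indicator {0..} h * ?m h)"
  proof (rule Bochner_Integration.integrable_bound[OF Bochner_Integration.integrable_add[OF near far]])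
    have "indicator {0..} h * ?m h \<le>
        indicator {0..1} h * h powr (1 - \<alpha>) + indicator {1..} h * h powr (- 1 - \<alpha>)" for h
    proof (cases "0 < h \<and> h \<le> 1")
      case True
      have "h\<^sup>2 * h powr (- 1 - \<alpha>) = h powr (1 - \<alpha>)"
        using True powr_add[of h 2 "- 1 - \<alpha>"] by simp
      moreover have "min 1 (h\<^sup>2) * h powr (- 1 - \<alpha>) \<le> h\<^sup>2 * h powr (- 1 - \<alpha>)"
        by (intro mult_right_mono) auto
      ultimately show ?thesis
        using True by (auto simp: frac_kernel_def indicator_def)
    next
      case False
      then show ?thesis
        by (auto simp: frac_kernel_def indicator_def intro!: mult_left_le_one_le)
    qed
    then show "AE h in lborel. norm (indicator {0..} h * ?m h) \<le>
        norm (indicator {0..1} h * h powr (1 - \<alpha>) + indicator {1..} h * h powr (- 1 - \<alpha>))"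
      by (intro AE_I2) (auto simp: abs_mult intro: order_trans[OF _ abs_ge_self])
  qed measurable
  have "integrable lborel (\<lambda>h. indicator {0..} h * ?m h + indicator {0..} (- h) * ?m (- h))"
    using half lborel_integrable_real_affine[OF half, of "-1" 0]
    by (intro Bochner_Integration.integrable_add) simp_all
  also have "(\<lambda>h. indicator {0..} h * ?m h + indicator {0..} (- h) * ?m (- h)) = ?m"
    by (auto simp: indicator_def fun_eq_iff)
  finally show ?thesis .
qed

lemma cos_second_diff_bound: "2 - 2 * cos (h * \<xi>) \<le> 4 * (min 1 (h\<^sup>2) * (1 + \<xi>\<^sup>2))" for h \<xi> :: real
proof -
  have s: "2 - 2 * cos (h * \<xi>) = 4 * (sin (h * \<xi> / 2))\<^sup>2"
    using cos_double_sin[of "h * \<xi> / 2"] by simp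
  have "(sin (h * \<xi> / 2))\<^sup>2 \<le> 1" by (simp add: abs_square_le_1)
  moreover have "(sin (h * \<xi> / 2))\<^sup>2 \<le> (h * \<xi> / 2)\<^sup>2"
    using abs_sin_x_le_abs_x by (simp only: abs_le_square_iff)
  moreover have "(h * \<xi> / 2)\<^sup>2 \<le> h\<^sup>2 * (1 + \<xi>\<^sup>2)"
    by (simp add: power_mult_distrib power_divide algebra_simps)
  ultimately have "(sin (h * \<xi> / 2))\<^sup>2 \<le> min 1 (h\<^sup>2) * (1 + \<xi>\<^sup>2)"
    using add_increasing2[of "\<xi>\<^sup>2" "(sin (h * \<xi> / 2))\<^sup>2" 1] by (cases "h\<^sup>2 \<le> 1") auto
  then show ?thesis unfolding s by simp
qed

lemma integrable_symbol:
  assumes "0 < \<alpha>" "\<alpha> < 2"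
  shows "integrable lborel (\<lambda>h. (2 - 2 * cos h) * frac_kernel \<alpha> h)"
proof (rule Bochner_Integration.integrable_bound[OF integrable_mult_right[OF integrable_truncated_kernel[OF assms], of 8]])
  have "(2 - 2 * cos h) * frac_kernel \<alpha> h \<le> 8 * (min 1 (h\<^sup>2) * frac_kernel \<alpha> h)" for h
    using mult_right_mono[OF cos_second_diff_bound[of h 1] frac_kernel_nonneg[of \<alpha> h]] by simp
  then show "AE h in lborel. norm ((2 - 2 * cos h) * frac_kernel \<alpha> h) \<le>
      norm (8 * (min 1 (h\<^sup>2) * frac_kernel \<alpha> h))"
    by (intro AE_I2) (simp add: abs_mult)
qed measurable

lemma symbol_const_pos:
  assumes "0 < \<alpha>" "\<alpha> < 2"
  shows "symbol_const \<alpha> > 0"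
proof -
  let ?c = "(2 - 2 * cos 1) * 2 powr (- 1 - \<alpha>)"
  \<comment> \<open>On \<open>[1, 2]\<close> the integrand is bounded below by the positive constant \<open>?c\<close>.\<close>
  have "cos 1 < cos (0::real)"
    using pi_ge_two by (intro cos_monotone_0_pi) auto
  then have "0 < ?c" by simp
  also have "?c = (LINT h|lborel. ?c * indicator {1..2::real} h)" by simp
  also have "\<dots> \<le> symbol_const \<alpha>"
    unfolding symbol_const_def
  proof (rule integral_mono[OF _ integrable_symbol[OF assms]])
    show "integrable lborel (\<lambda>h. ?c * indicator {1..2::real} h)"
      by (intro integrable_mult_right integrable_real_indicator) auto
    fix h :: real
    show "?c * indicator {1..2} h \<le> (2 - 2 * cos h) * frac_kernel \<alpha> h"
    proof (cases "h \<in> {1..2}")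
      case True
      then have "cos h \<le> cos 1"
        using pi_ge_two by (intro cos_monotone_0_pi_le) auto
      moreover have "2 powr (- 1 - \<alpha>) \<le> frac_kernel \<alpha> h"
        using True assms by (auto simp: frac_kernel_def intro!: powr_mono2')
      ultimately have "?c \<le> (2 - 2 * cos h) * frac_kernel \<alpha> h"
        by (intro mult_mono) auto
      then show ?thesis using True by simp
    qed simp
  qed
  finally show ?thesis .
qed

text \<open>The substitution \<open>h \<mapsto> \<xi> h\<close> and the homogeneity of the kernel.\<close>

lemma symbol_scaling:
  assumes "0 < \<alpha>"
  shows "(LINT h|lborel. (2 - 2 * cos (h * \<xi>)) * frac_kernel \<alpha> h) = \<bar>\<xi>\<bar> powr \<alpha> * symbol_const \<alpha>"
proof (cases "\<xi> = 0")
  case False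
  have "symbol_const \<alpha> = \<bar>\<xi>\<bar> *\<^sub>R (LINT h|lborel. (2 - 2 * cos (0 + \<xi> * h)) * frac_kernel \<alpha> (0 + \<xi> * h))"
    unfolding symbol_const_def by (rule lborel_integral_real_affine[OF False])
  also have "\<dots> = \<bar>\<xi>\<bar> * (LINT h|lborel. \<bar>\<xi>\<bar> powr (- 1 - \<alpha>) * ((2 - 2 * cos (h * \<xi>)) * frac_kernel \<alpha> h))"
    unfolding add_0_left frac_kernel_scale by (simp add: mult_ac)
  also have "\<dots> = \<bar>\<xi>\<bar> * (\<bar>\<xi>\<bar> powr (- 1 - \<alpha>) * (LINT h|lborel. (2 - 2 * cos (h * \<xi>)) * frac_kernel \<alpha> h))"
    by (subst integral_mult_right_zero) simp
  also have "\<bar>\<xi>\<bar> * (\<bar>\<xi>\<bar> powr (- 1 - \<alpha>) * I) = \<bar>\<xi>\<bar> powr (- \<alpha>) * I" for I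
    using False powr_add[of "\<bar>\<xi>\<bar>" 1 "- 1 - \<alpha>"] by simp
  finally show ?thesis
    using False by (simp add: powr_minus field_simps)
qed simp

lemma powr_le_bracket_square:
  assumes "0 \<le> s" "s \<le> 2"
  shows "\<bar>\<xi>::real\<bar> powr s \<le> 1 + \<xi>\<^sup>2"
proof (cases "\<bar>\<xi>\<bar> \<le> 1")
  case True
  then have "\<bar>\<xi>\<bar> powr s \<le> 1" using assms by (intro powr_le1) auto
  then show ?thesis using zero_le_power2[of \<xi>] by linarith
next
  case False
  then have "\<bar>\<xi>\<bar> powr s \<le> \<bar>\<xi>\<bar> powr 2" using assms by (intro powr_mono) auto
  then show ?thesis using False by simp
qed

lemma abs_D_measurable [measurable]:
  assumes [measurable]: "f \<in> borel_measurable borel"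
  shows "abs_D s f \<in> borel_measurable borel"
  unfolding abs_D_def[abs_def] fourier_multiplier_def by measurable

lemma abs_D_cmult: "abs_D s (\<lambda>y. c * f y) x = c * abs_D s f x"
proof -
  have "fourier (\<lambda>y. complex_of_real (c * f y)) \<xi> = of_real c * fourier (\<lambda>y. of_real (f y)) \<xi>" for \<xi>
    unfolding fourier_def by (simp add: mult.left_commute flip: integral_mult_right_zero)
  then have "fourier_multiplier m (\<lambda>y. complex_of_real (c * f y)) x =
      of_real c * fourier_multiplier m (\<lambda>y. complex_of_real (f y)) x" for m
    unfolding fourier_multiplier_def
    by (simp add: mult.left_commute[of _ "complex_of_real c"])
  then show ?thesis by (simp add: abs_D_def)
qed

lemma abs_D_bounded:
  assumes f: "derivs_within (\<lambda>x. inverse (1 + x\<^sup>2)) 4 f" and s: "0 \<le> s" "s \<le> 2"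
  shows "\<exists>C. \<forall>x. \<bar>abs_D s f x\<bar> \<le> C"
proof -
  let ?F = "fourier (\<lambda>y. complex_of_real (f y))"
  let ?M = "LINT \<xi>|lborel. (1 + \<xi>\<^sup>2) * cmod (?F \<xi>)"
  have "\<bar>abs_D s f x\<bar> \<le> 1 / (2 * pi) * ?M" for x
  proof -
    have "cmod (LINT \<xi>|lborel. exp (\<i> * of_real (x * \<xi>)) * of_real (\<bar>\<xi>\<bar> powr s) * ?F \<xi>) \<le> ?M"
    proof (rule Bochner_Integration.integral_norm_bound_integral[OF _ fourier_weight_integrable[OF f]])
      show le: "cmod (exp (\<i> * of_real (x * \<xi>)) * of_real (\<bar>\<xi>\<bar> powr s) * ?F \<xi>) \<le>
          (1 + \<xi>\<^sup>2) * cmod (?F \<xi>)" for \<xi>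
        using powr_le_bracket_square[OF s, of \<xi>] by (auto simp: norm_mult intro!: mult_right_mono)
      note [measurable] = derivs_within_measurable[OF f]
      show "integrable lborel (\<lambda>\<xi>. exp (\<i> * of_real (x * \<xi>)) * of_real (\<bar>\<xi>\<bar> powr s) * ?F \<xi>)"
        using le by (intro Bochner_Integration.integrable_bound[OF fourier_weight_integrable[OF f]])
          (auto intro!: AE_I2 intro: order_trans[OF _ abs_ge_self])
    qed
    then show ?thesis
      unfolding abs_D_def fourier_multiplier_def
      by (intro order_trans[OF abs_Re_le_cmod]) (simp add: norm_mult norm_divide divide_right_mono)
  qed
  then show ?thesis by blast
qed

text \<open>By Fourier inversion, the second difference of \<open>f\<close> at \<open>x\<close> with step \<open>h\<close> is the inverse transform of the
transform of \<open>f\<close> multiplied by \<open>2 - 2 cos(h \<xi>)\<close>. Integrating this factor in \<open>h\<close> against the kernel first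
produces the symbol \<open>|\<xi>|\<^sup>\<alpha>\<close>.\<close>

lemma abs_D_eq_singular_frac:
  assumes f: "derivs_within (\<lambda>x. inverse (1 + x\<^sup>2)) 4 f" and \<alpha>: "0 < \<alpha>" "\<alpha> < 2"
  shows "symbol_const \<alpha> * abs_D \<alpha> f x = singular_frac \<alpha> f x"
proof -
  let ?F = "fourier (\<lambda>y. complex_of_real (f y))"
  let ?e = "\<lambda>x \<xi>. exp (\<i> * complex_of_real (x * \<xi>))"
  let ?G = "\<lambda>\<xi> h. ?e x \<xi> * ?F \<xi> * of_real ((2 - 2 * cos (h * \<xi>)) * frac_kernel \<alpha> h)"
  have fc: "continuous_on UNIV f" using derivs_within_continuous[OF f] .
  then have [measurable]: "f \<in> borel_measurable borel" by (rule borel_measurable_continuous_onI)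
  note W = fourier_weight_integrable[OF f]
  obtain C where C: "\<And>x. \<bar>f x\<bar> \<le> C * inverse (1 + x\<^sup>2)" using derivs_within_bound[OF f] by blast
  have bd: "\<bar>f x\<bar> \<le> \<bar>C\<bar>" for x
  proof -
    have "C * inverse (1 + x\<^sup>2) \<le> \<bar>C\<bar> * 1"
      by (intro mult_mono) (auto simp: inverse_le_1_iff add_pos_nonneg)
    then show ?thesis using C[of x] by simp
  qed
  have Fi: "integrable lborel (\<lambda>\<xi>. cmod (?F \<xi>))"
    by (rule Bochner_Integration.integrable_bound[OF W])
      (auto intro!: AE_I2 simp: abs_mult intro!: mult_le_cancel_right1[THEN iffD2])
  have inv: "(LINT \<xi>|lborel. ?e x \<xi> * ?F \<xi>) = of_real (2 * pi * f x)" for x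
    by (rule fourier_inversion[OF fc derivs_within_integrable[OF f] bd Fi])
  have ei: "integrable lborel (\<lambda>\<xi>. ?e x \<xi> * ?F \<xi>)" for x
    by (rule Bochner_Integration.integrable_bound[OF Fi]) (auto simp: norm_mult)
  have split: "?e x \<xi> * ?F \<xi> * of_real (2 - 2 * cos (h * \<xi>)) =
      2 * (?e x \<xi> * ?F \<xi>) - ?e (x + h) \<xi> * ?F \<xi> - ?e (x - h) \<xi> * ?F \<xi>" for \<xi> h
  proof -
    have "complex_of_real (cos t) = (exp (\<i> * of_real t) + exp (- (\<i> * of_real t))) / 2" for t
      by (metis cos_of_real cos_exp_eq)
    from this[of "h * \<xi>"] have c: "of_real (2 - 2 * cos (h * \<xi>)) = 2 - exp (\<i> * of_real (h * \<xi>)) - exp (- (\<i> * of_real (h * \<xi>)))"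
      by (simp add: diff_divide_distrib add_divide_distrib algebra_simps of_real_diff of_real_mult[of 2] del: of_real_mult)
    have e: "?e (x + h) \<xi> = ?e x \<xi> * exp (\<i> * of_real (h * \<xi>))"
      "?e (x - h) \<xi> = ?e x \<xi> * exp (- (\<i> * of_real (h * \<xi>)))"
      by (simp_all add: exp_add[symmetric] algebra_simps)
    have "z * w * (2 - a - b) = 2 * (z * w) - z * a * w - z * b * w" for z w a b :: complex
      by (simp add: algebra_simps)
    then show ?thesis unfolding c e .
  qed
  have lin: "(LINT \<xi>|lborel. 2 * a \<xi> - b \<xi> - c \<xi>) = 2 * integral\<^sup>L lborel a - integral\<^sup>L lborel b - integral\<^sup>L lborel c"
    if "integrable lborel a" "integrable lborel b" "integrable lborel c" for a b c :: "real \<Rightarrow> complex"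
    using that by simp
  have sd: "of_real (2 * pi * second_diff f x h) =
      (LINT \<xi>|lborel. ?e x \<xi> * ?F \<xi> * of_real (2 - 2 * cos (h * \<xi>)))" for h
    unfolding split lin[OF ei ei ei] inv by (simp add: second_diff_def algebra_simps)
  have "of_real (2 * pi * singular_frac \<alpha> f x) =
      (LINT h|lborel. complex_of_real (2 * pi * second_diff f x h) * of_real (frac_kernel \<alpha> h))"
    unfolding singular_frac_def
    by (simp add: mult.assoc flip: of_real_mult integral_mult_right_zero integral_complex_of_real)
  also have "\<dots> = (LINT h|lborel. LINT \<xi>|lborel. ?G \<xi> h)"
    unfolding sd by (simp add: mult.assoc flip: integral_mult_left_zero)
  also have "\<dots> = (LINT \<xi>|lborel. LINT h|lborel. ?G \<xi> h)"
  proof (rule lborel_pair.Fubini_integral, rule integrable_pair_bound)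
    show "norm (?G \<xi> h) \<le> (1 + \<xi>\<^sup>2) * cmod (?F \<xi>) * (4 * (min 1 (h\<^sup>2) * frac_kernel \<alpha> h))" for \<xi> h
    proof -
      have "norm (?G \<xi> h) = cmod (?F \<xi>) * \<bar>(2 - 2 * cos (h * \<xi>)) * frac_kernel \<alpha> h\<bar>"
        by (simp only: norm_mult norm_of_real norm_exp_i_times mult_1_left)
      also have "\<dots> = cmod (?F \<xi>) * ((2 - 2 * cos (h * \<xi>)) * frac_kernel \<alpha> h)"
        by (simp add: abs_mult)
      also have "\<dots> \<le> cmod (?F \<xi>) * (4 * (min 1 (h\<^sup>2) * (1 + \<xi>\<^sup>2)) * frac_kernel \<alpha> h)"
        by (intro mult_left_mono mult_right_mono cos_second_diff_bound) auto
      finally show ?thesis by (simp add: mult_ac)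
    qed
    show "integrable lborel (\<lambda>h. 4 * (min 1 (h\<^sup>2) * frac_kernel \<alpha> h))"
      using integrable_truncated_kernel[OF \<alpha>] by simp
  qed (use W in \<open>auto\<close>)
  also have "\<dots> = (LINT \<xi>|lborel. ?e x \<xi> * of_real (\<bar>\<xi>\<bar> powr \<alpha>) * ?F \<xi> * of_real (symbol_const \<alpha>))"
    unfolding integral_mult_right_zero integral_complex_of_real symbol_scaling[OF \<alpha>(1)]
    by (simp only: of_real_mult mult_ac)
  also have "\<dots> = of_real (2 * pi * (symbol_const \<alpha> * abs_D \<alpha> f x))"
    by (simp add: of_real_abs_D fourier_multiplier_def)
  finally show ?thesis by (simp only: of_real_eq_iff) simp
qed

section \<open>The product rule and the symmetry of the singular integral\<close>

lemma diff_le_deriv_bound: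
  assumes "\<And>z. (f has_real_derivative f' z) (at z)" "\<And>z. \<bar>z - x\<bar> \<le> \<bar>h\<bar> \<Longrightarrow> \<bar>f' z\<bar> \<le> M"
    and "\<bar>y - x\<bar> \<le> \<bar>h\<bar>" "\<bar>z - x\<bar> \<le> \<bar>h\<bar>"
  shows "\<bar>f y - f z\<bar> \<le> M * \<bar>y - z\<bar>"
proof -
  have "norm (f y - f z) \<le> M * norm (y - z)"
  proof (rule field_differentiable_bound)
    show "(f has_field_derivative f' t) (at t within cball x \<bar>h\<bar>)" for t
      by (rule DERIV_subset[OF assms(1)]) simp
    show "norm (f' t) \<le> M" if "t \<in> cball x \<bar>h\<bar>" for t
      using assms(2)[of t] that by (simp add: dist_real_def abs_minus_commute)
  qed (use assms in \<open>auto simp: dist_real_def abs_minus_commute\<close>)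
  then show ?thesis by simp
qed

text \<open>The bound is needed on the interval of radius \<open>|h|\<close> around \<open>x\<close> only; this is what makes it usable for the
weight, whose derivatives are bounded by the local size of the weight.\<close>

lemma second_diff_le_deriv_bound:
  assumes f: "\<And>z. (f has_real_derivative f' z) (at z)"
    and f': "\<And>z. (f' has_real_derivative f'' z) (at z)"
    and M: "\<And>z. \<bar>z - x\<bar> \<le> \<bar>h\<bar> \<Longrightarrow> \<bar>f'' z\<bar> \<le> M"
  shows "\<bar>second_diff f x h\<bar> \<le> 2 * M * h\<^sup>2"
proof -
  \<comment> \<open>The second difference is \<open>G(0) - G(h)\<close>, and \<open>G'\<close> is a difference of values of \<open>f'\<close>.\<close>
  let ?G = "\<lambda>t. f (x + t) + f (x - t)"
  have M0: "0 \<le> M" using order_trans[OF abs_ge_zero M[of x]] by simp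
  have G: "(?G has_real_derivative f' (x + t) - f' (x - t)) (at t)" for t
  proof -
    have "((\<lambda>t. x + t) has_real_derivative 1) (at t)" "((\<lambda>t. x - t) has_real_derivative - 1) (at t)"
      by (auto intro!: derivative_eq_intros)
    then have "((\<lambda>t. f (x + t)) has_real_derivative f' (x + t) * 1) (at t)"
      "((\<lambda>t. f (x - t)) has_real_derivative f' (x - t) * - 1) (at t)"
      using DERIV_chain2[of f "f' (x + t)" "\<lambda>t. x + t" t 1 UNIV]
        DERIV_chain2[of f "f' (x - t)" "\<lambda>t. x - t" t "- 1" UNIV] f by auto
    from DERIV_add[OF this] show ?thesis by simp
  qed
  have "\<bar>?G h - ?G 0\<bar> \<le> (2 * M * \<bar>h\<bar>) * \<bar>h - 0\<bar>"
  proof (rule diff_le_deriv_bound[OF G])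
    fix t assume t: "\<bar>t - 0\<bar> \<le> \<bar>h\<bar>"
    have "\<bar>f' (x + t) - f' (x - t)\<bar> \<le> M * \<bar>(x + t) - (x - t)\<bar>"
      using t by (intro diff_le_deriv_bound[OF f' M]) auto
    also have "\<dots> \<le> M * (2 * \<bar>h\<bar>)" using t M0 by (intro mult_left_mono) auto
    finally show "\<bar>f' (x + t) - f' (x - t)\<bar> \<le> 2 * M * \<bar>h\<bar>" by simp
  qed auto
  then show ?thesis
    by (simp add: second_diff_def power2_eq_square abs_if split: if_splits)
qed

lemma diff_product_bound:
  assumes f: "derivs_within (\<lambda>_. 1) 1 f" and g: "derivs_within (\<lambda>_. 1) 1 g"
  shows "\<exists>C. \<forall>x h. \<bar>(f x - f (x + h)) * (g x - g (x + h))\<bar> \<le> C * min 1 (h\<^sup>2)"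
proof -
  have *: "\<exists>C. \<forall>x h. \<bar>f x - f (x + h)\<bar> \<le> C * min 1 \<bar>h\<bar>" if f: "derivs_within (\<lambda>_. 1) 1 f" for f
  proof -
    obtain C D f' where C: "\<And>x. \<bar>f x\<bar> \<le> C" and D: "\<And>x. \<bar>f' x\<bar> \<le> D"
      and f': "\<And>x. (f has_real_derivative f' x) (at x)"
      using f by (auto simp: One_nat_def)
    have "\<bar>f x - f (x + h)\<bar> \<le> (2 * C + D) * min 1 \<bar>h\<bar>" for x h
    proof -
      have 0: "0 \<le> C" "0 \<le> D" using C[of 0] D[of 0] by linarith+
      have "\<bar>f x - f (x + h)\<bar> \<le> D * \<bar>x - (x + h)\<bar>"
        by (rule diff_le_deriv_bound[OF f', of x h]) (use D in auto)
      moreover have "\<bar>f x - f (x + h)\<bar> \<le> 2 * C" using C[of x] C[of "x + h"] by linarith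
      ultimately show ?thesis
      proof (cases "\<bar>h\<bar> \<le> 1")
        case True
        have "D * \<bar>h\<bar> \<le> (2 * C + D) * \<bar>h\<bar>" using 0 by (intro mult_right_mono) auto
        with True \<open>\<bar>f x - f (x + h)\<bar> \<le> D * \<bar>x - (x + h)\<bar>\<close> show ?thesis by simp
      qed (use 0 in auto)
    qed
    then show ?thesis by blast
  qed
  obtain C D where C: "\<And>x h. \<bar>f x - f (x + h)\<bar> \<le> C * min 1 \<bar>h\<bar>"
    and D: "\<And>x h. \<bar>g x - g (x + h)\<bar> \<le> D * min 1 \<bar>h\<bar>"
    using *[OF f] *[OF g] by blast
  have "\<bar>(f x - f (x + h)) * (g x - g (x + h))\<bar> \<le> (C * D) * min 1 (h\<^sup>2)" for x h
  proof -
    have "\<bar>(f x - f (x + h)) * (g x - g (x + h))\<bar> \<le> (C * min 1 \<bar>h\<bar>) * (D * min 1 \<bar>h\<bar>)"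
      unfolding abs_mult using C[of x h] D[of x h] by (intro mult_mono) (auto intro: order_trans[OF abs_ge_zero])
    also have "\<dots> = (C * D) * (min 1 \<bar>h\<bar>)\<^sup>2" by (simp add: power2_eq_square)
    also have "(min 1 \<bar>h\<bar>)\<^sup>2 = min 1 (h\<^sup>2)"
      using abs_square_le_1[of h] by (cases "\<bar>h\<bar> \<le> 1") auto
    finally show ?thesis .
  qed
  then show ?thesis by blast
qed

lemma second_diff_bound:
  assumes "derivs_within (\<lambda>_. 1) 2 f"
  shows "\<exists>C. \<forall>x h. \<bar>second_diff f x h\<bar> \<le> C * min 1 (h\<^sup>2)"
proof -
  obtain f' f'' C D where C: "\<And>x. \<bar>f x\<bar> \<le> C" and D: "\<And>x. \<bar>f'' x\<bar> \<le> D"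
    and f': "\<And>x. (f has_real_derivative f' x) (at x)" and f'': "\<And>x. (f' has_real_derivative f'' x) (at x)"
    using assms by (auto simp: numeral_2_eq_2)
  have "\<bar>second_diff f x h\<bar> \<le> (4 * C + 2 * D) * min 1 (h\<^sup>2)" for x h
  proof -
    have "0 \<le> C" "0 \<le> D" using C[of 0] D[of 0] by linarith+
    moreover have "\<bar>second_diff f x h\<bar> \<le> 2 * D * h\<^sup>2"
      by (rule second_diff_le_deriv_bound[OF f' f'']) (rule D)
    moreover have "\<bar>second_diff f x h\<bar> \<le> 4 * C"
      using C[of x] C[of "x + h"] C[of "x - h"] unfolding second_diff_def by linarith
    ultimately show ?thesis
      by (cases "h\<^sup>2 \<le> 1") (auto simp: distrib_right intro: add_increasing add_increasing2)
  qed
  then show ?thesis by blast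
qed

context
  fixes \<alpha> :: real
  assumes \<alpha>: "0 < \<alpha>" "\<alpha> < 2"
begin

lemma kernel_domination:
  assumes [measurable]: "F \<in> borel_measurable borel" and F: "\<And>h. \<bar>F h\<bar> \<le> C * min 1 (h\<^sup>2)"
  shows "integrable lborel (\<lambda>h. F h * frac_kernel \<alpha> h)"
    and "\<bar>LINT h|lborel. F h * frac_kernel \<alpha> h\<bar> \<le> C * (LINT h|lborel. min 1 (h\<^sup>2) * frac_kernel \<alpha> h)"
proof -
  have le: "norm (F h * frac_kernel \<alpha> h) \<le> C * (min 1 (h\<^sup>2) * frac_kernel \<alpha> h)" for h
    using mult_right_mono[OF F[of h] frac_kernel_nonneg[of \<alpha> h]] by (simp add: abs_mult mult.assoc)
  have i: "integrable lborel (\<lambda>h. C * (min 1 (h\<^sup>2) * frac_kernel \<alpha> h))"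
    by (intro integrable_mult_right integrable_truncated_kernel \<alpha>)
  show I: "integrable lborel (\<lambda>h. F h * frac_kernel \<alpha> h)"
    by (rule Bochner_Integration.integrable_bound[OF i])
      (use le in \<open>auto intro!: AE_I2 intro: order_trans[OF _ abs_ge_self]\<close>)
  show "\<bar>LINT h|lborel. F h * frac_kernel \<alpha> h\<bar> \<le> C * (LINT h|lborel. min 1 (h\<^sup>2) * frac_kernel \<alpha> h)"
    using Bochner_Integration.integral_norm_bound_integral[OF I i le] by simp
qed

lemma integrable_second_diff:
  assumes f: "derivs_within (\<lambda>_. 1) 2 f"
  shows "integrable lborel (\<lambda>h. second_diff f x h * frac_kernel \<alpha> h)"
proof -
  note [measurable] = derivs_within_measurable[OF f]
  obtain C where "\<And>x h. \<bar>second_diff f x h\<bar> \<le> C * min 1 (h\<^sup>2)" using second_diff_bound[OF f] by blast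
  then show ?thesis by (intro kernel_domination(1)[of _ C]) (auto simp: second_diff_def)
qed

lemma integrable_carre:
  assumes f: "derivs_within (\<lambda>_. 1) 1 f" and g: "derivs_within (\<lambda>_. 1) 1 g"
  shows "integrable lborel (\<lambda>h. (f x - f (x + h)) * (g x - g (x + h)) * frac_kernel \<alpha> h)"
proof -
  note [measurable] = derivs_within_measurable[OF f] derivs_within_measurable[OF g]
  obtain C where "\<And>x h. \<bar>(f x - f (x + h)) * (g x - g (x + h))\<bar> \<le> C * min 1 (h\<^sup>2)"
    using diff_product_bound[OF f g] by blast
  then show ?thesis by (intro kernel_domination(1)[of _ C]) auto
qed

lemma carre_nonneg: "carre_du_champ \<alpha> f f x \<ge> 0"
  unfolding carre_du_champ_def by (intro integral_nonneg_AE AE_I2) simp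

lemma carre_bounded:
  assumes f: "derivs_within (\<lambda>_. 1) 1 f"
  shows "\<exists>C. \<forall>x. carre_du_champ \<alpha> f f x \<le> C"
proof -
  note [measurable] = derivs_within_measurable[OF f]
  obtain C where "\<And>x h. \<bar>(f x - f (x + h)) * (f x - f (x + h))\<bar> \<le> C * min 1 (h\<^sup>2)"
    using diff_product_bound[OF f f] by blast
  then have "\<bar>carre_du_champ \<alpha> f f x\<bar> \<le> C * (LINT h|lborel. min 1 (h\<^sup>2) * frac_kernel \<alpha> h)" for x
    unfolding carre_du_champ_def by (intro kernel_domination(2)) auto
  then show ?thesis by (meson abs_ge_self order_trans)
qed

text \<open>For a single step \<open>h\<close> the second difference of \<open>f g\<close> is \<open>f\<close> times that of \<open>g\<close> plus \<open>g\<close> times that of \<open>f\<close>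
minus the two products of first differences with steps \<open>h\<close> and \<open>-h\<close>. These two have the same integral
against the even kernel.\<close>

lemma singular_frac_mult:
  assumes f: "derivs_within (\<lambda>_. 1) 2 f" and g: "derivs_within (\<lambda>_. 1) 2 g"
  shows "singular_frac \<alpha> (\<lambda>y. f y * g y) x =
     f x * singular_frac \<alpha> g x + g x * singular_frac \<alpha> f x - 2 * carre_du_champ \<alpha> f g x"
proof -
  let ?b = "\<lambda>h. (f x - f (x + h)) * (g x - g (x + h)) * frac_kernel \<alpha> h"
  have f1: "derivs_within (\<lambda>_. 1) 1 f" by (rule derivs_within_mono[OF f]) simp
  have g1: "derivs_within (\<lambda>_. 1) 1 g" by (rule derivs_within_mono[OF g]) simp
  note I = integrable_second_diff[OF f, of x] integrable_second_diff[OF g, of x]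
  have b: "integrable lborel ?b" by (rule integrable_carre[OF f1 g1])
  have b': "integrable lborel (\<lambda>h. ?b (- h))" "(LINT h|lborel. ?b (- h)) = carre_du_champ \<alpha> f g x"
    using lborel_integrable_real_affine[OF b, of "- 1" 0] lborel_integral_real_affine[of "- 1" ?b 0]
    by (simp_all add: carre_du_champ_def)
  have "singular_frac \<alpha> (\<lambda>y. f y * g y) x = (LINT h|lborel.
      f x * (second_diff g x h * frac_kernel \<alpha> h) + g x * (second_diff f x h * frac_kernel \<alpha> h)
      - ?b h - ?b (- h))"
    unfolding singular_frac_def
    by (intro Bochner_Integration.integral_cong refl) (simp add: second_diff_def algebra_simps)
  also have "\<dots> = f x * singular_frac \<alpha> g x + g x * singular_frac \<alpha> f x
      - (LINT h|lborel. ?b h) - (LINT h|lborel. ?b (- h))"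
    unfolding singular_frac_def
    using I b b'(1) by (simp del: frac_kernel_minus add_uminus_conv_diff)
  also have "(LINT h|lborel. ?b h) = carre_du_champ \<alpha> f g x" by (simp add: carre_du_champ_def)
  finally show ?thesis unfolding b'(2) by simp
qed

text \<open>A Cauchy--Schwarz inequality with the two factors distributed freely; in this form no square roots of
integrals appear, and the powers of the dilation parameter can be balanced through \<open>c\<close> and \<open>d\<close>.\<close>

lemma carre_young:
  assumes f: "derivs_within (\<lambda>_. 1) 1 f" and g: "derivs_within (\<lambda>_. 1) 1 g"
  shows "2 * \<bar>c * d * carre_du_champ \<alpha> f g x\<bar> \<le> c\<^sup>2 * carre_du_champ \<alpha> f f x + d\<^sup>2 * carre_du_champ \<alpha> g g x"
proof -
  let ?b = "\<lambda>f g h. (f x - f (x + h)) * (g x - g (x + h)) * frac_kernel \<alpha> h"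
  note I = integrable_carre[OF f g, of x] integrable_carre[OF f f, of x] integrable_carre[OF g g, of x]
  have "2 * (s * c * d * carre_du_champ \<alpha> f g x) \<le> c\<^sup>2 * carre_du_champ \<alpha> f f x + d\<^sup>2 * carre_du_champ \<alpha> g g x" if "s\<^sup>2 = 1" for s
  proof -
    have "0 \<le> (LINT h|lborel. (c * (f x - f (x + h)) - s * d * (g x - g (x + h)))\<^sup>2 * frac_kernel \<alpha> h)"
      by (intro integral_nonneg_AE AE_I2) simp
    also have "\<dots> = (LINT h|lborel. c\<^sup>2 * ?b f f h + s\<^sup>2 * d\<^sup>2 * ?b g g h - 2 * (s * c * d) * ?b f g h)"
      by (intro Bochner_Integration.integral_cong refl) (simp add: power2_eq_square algebra_simps)
    also have "\<dots> = c\<^sup>2 * carre_du_champ \<alpha> f f x + s\<^sup>2 * d\<^sup>2 * carre_du_champ \<alpha> g g x - 2 * (s * c * d) * carre_du_champ \<alpha> f g x"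
      unfolding carre_du_champ_def using I by simp
    finally show ?thesis using that by simp
  qed
  from this[of 1] this[of "- 1"] show ?thesis by (simp add: abs_if)
qed

text \<open>For each fixed step \<open>h\<close> translation invariance moves the second difference from one factor to the other.\<close>

lemma singular_frac_symmetric:
  assumes f: "derivs_within (\<lambda>_. 1) 2 f" "integrable lborel f"
    and g: "derivs_within (\<lambda>_. 1) 2 g" "integrable lborel g"
  shows "(LINT x|lborel. g x * singular_frac \<alpha> f x) = (LINT x|lborel. f x * singular_frac \<alpha> g x)"
proof -
  have swap: "(LINT x|lborel. g x * singular_frac \<alpha> f x) =
      (LINT h|lborel. (LINT x|lborel. g x * second_diff f x h) * frac_kernel \<alpha> h)"
    if f: "derivs_within (\<lambda>_. 1) 2 f" and g: "derivs_within (\<lambda>_. 1) 2 g" "integrable lborel g" for f g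
  proof -
    note [measurable] = derivs_within_measurable[OF f] derivs_within_measurable[OF g(1)]
    obtain C where C: "\<And>x h. \<bar>second_diff f x h\<bar> \<le> C * min 1 (h\<^sup>2)" using second_diff_bound[OF f] by blast
    have "(LINT x|lborel. g x * singular_frac \<alpha> f x) =
        (LINT x|lborel. LINT h|lborel. g x * second_diff f x h * frac_kernel \<alpha> h)"
      unfolding singular_frac_def by (simp add: mult.assoc)
    also have "\<dots> = (LINT h|lborel. LINT x|lborel. g x * second_diff f x h * frac_kernel \<alpha> h)"
    proof (rule lborel_pair.Fubini_integral[symmetric], rule integrable_pair_bound)
      show "norm (g x * second_diff f x h * frac_kernel \<alpha> h) \<le> \<bar>g x\<bar> * (C * (min 1 (h\<^sup>2) * frac_kernel \<alpha> h))" for x h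
      proof -
        have "\<bar>g x\<bar> * \<bar>second_diff f x h\<bar> * frac_kernel \<alpha> h \<le> \<bar>g x\<bar> * (C * min 1 (h\<^sup>2)) * frac_kernel \<alpha> h"
          by (intro mult_right_mono mult_left_mono C) auto
        then show ?thesis by (simp add: abs_mult mult.assoc)
      qed
      show "integrable lborel (\<lambda>h. C * (min 1 (h\<^sup>2) * frac_kernel \<alpha> h))"
        by (intro integrable_mult_right integrable_truncated_kernel \<alpha>)
    qed (use g in \<open>auto simp: second_diff_def\<close>)
    finally show ?thesis by simp
  qed
  have move: "(LINT x|lborel. g x * second_diff f x h) = (LINT x|lborel. f x * second_diff g x h)" for h
  proof -
    note [measurable] = derivs_within_measurable[OF f(1)] derivs_within_measurable[OF g(1)]
    obtain C where C: "\<And>x. \<bar>f x\<bar> \<le> C" using derivs_within_bound[OF f(1)] by auto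
    have i: "integrable lborel (\<lambda>x. g x * f (x + h))" for h
      by (rule Bochner_Integration.integrable_bound[OF integrable_mult_right[OF g(2), of C]])
        (use C in \<open>auto simp: abs_mult mult.commute[of C] intro!: AE_I2 mult_left_mono intro: order_trans[OF _ abs_ge_self]\<close>)
    have t: "(LINT x|lborel. g x * f (x + h)) = (LINT x|lborel. g (x - h) * f x)"
      "integrable lborel (\<lambda>x. g (x - h) * f x)" for h
      using lborel_integral_real_affine[of 1 "\<lambda>x. g x * f (x + h)" "- h"]
        lborel_integrable_real_affine[OF i[of h], of 1 "- h"] by (simp_all add: algebra_simps)
    have "(LINT x|lborel. g x * second_diff f x h) =
        (LINT x|lborel. 2 * (g x * f (x + 0)) - g x * f (x + h) - g x * f (x + - h))"
      by (intro Bochner_Integration.integral_cong refl) (simp add: second_diff_def algebra_simps)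
    also have "\<dots> = 2 * (LINT x|lborel. g x * f (x + 0)) - (LINT x|lborel. g x * f (x + h))
        - (LINT x|lborel. g x * f (x + - h))"
      using i[of 0] i[of h] i[of "- h"] by (simp del: add_uminus_conv_diff add_0_right)
    also have "\<dots> = 2 * (LINT x|lborel. g (x - 0) * f x) - (LINT x|lborel. g (x - h) * f x)
        - (LINT x|lborel. g (x - - h) * f x)"
      unfolding t ..
    also have "\<dots> = (LINT x|lborel. 2 * (g (x - 0) * f x) - g (x - h) * f x - g (x - - h) * f x)"
      using t(2)[of 0] t(2)[of h] t(2)[of "- h"] by (simp del: diff_minus_eq_add diff_0_right)
    also have "\<dots> = (LINT x|lborel. f x * second_diff g x h)"
      by (intro Bochner_Integration.integral_cong refl) (simp add: second_diff_def algebra_simps)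
    finally show ?thesis .
  qed
  show ?thesis
    unfolding swap[OF f(1) g] swap[OF g(1) f] move ..
qed

end

text \<open>Homogeneity of degree \<open>-\<alpha>\<close>, here and in the next lemma, is the source of the negative powers of \<open>A\<close> in
the final estimate.\<close>

lemma singular_frac_dilate:
  assumes "A > 0"
  shows "singular_frac \<alpha> (\<lambda>y. f (y / A)) x = A powr (- \<alpha>) * singular_frac \<alpha> f (x / A)"
proof -
  have p: "A * (A powr (- 1 - \<alpha>) * I) = A powr (- \<alpha>) * I" for I
    using assms powr_add[of A 1 "- 1 - \<alpha>"] by simp
  have "singular_frac \<alpha> (\<lambda>y. f (y / A)) x =
      \<bar>A\<bar> *\<^sub>R (LINT h|lborel. second_diff (\<lambda>y. f (y / A)) x (0 + A * h) * frac_kernel \<alpha> (0 + A * h))"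
    unfolding singular_frac_def by (rule lborel_integral_real_affine) (use assms in simp)
  also have "\<dots> = A * (LINT h|lborel. A powr (- 1 - \<alpha>) * (second_diff f (x / A) h * frac_kernel \<alpha> h))"
    unfolding add_0_left frac_kernel_scale using assms
    by (simp add: second_diff_def add_divide_distrib diff_divide_distrib mult_ac)
  also have "\<dots> = A powr (- \<alpha>) * singular_frac \<alpha> f (x / A)"
    unfolding integral_mult_right_zero singular_frac_def by (rule p)
  finally show ?thesis .
qed

lemma carre_dilate:
  assumes "A > 0"
  shows "carre_du_champ \<alpha> (\<lambda>y. f (y / A)) (\<lambda>y. g (y / A)) x = A powr (- \<alpha>) * carre_du_champ \<alpha> f g (x / A)"
proof -
  have p: "A * (A powr (- 1 - \<alpha>) * I) = A powr (- \<alpha>) * I" for I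
    using assms powr_add[of A 1 "- 1 - \<alpha>"] by simp
  have "carre_du_champ \<alpha> (\<lambda>y. f (y / A)) (\<lambda>y. g (y / A)) x =
      \<bar>A\<bar> *\<^sub>R (LINT h|lborel. (f (x / A) - f ((x + (0 + A * h)) / A)) * (g (x / A) - g ((x + (0 + A * h)) / A))
        * frac_kernel \<alpha> (0 + A * h))"
    unfolding carre_du_champ_def by (rule lborel_integral_real_affine) (use assms in simp)
  also have "\<dots> = A * (LINT h|lborel. A powr (- 1 - \<alpha>) *
      ((f (x / A) - f (x / A + h)) * (g (x / A) - g (x / A + h)) * frac_kernel \<alpha> h))"
    unfolding add_0_left frac_kernel_scale using assms
    by (simp add: add_divide_distrib mult_ac)
  also have "\<dots> = A powr (- \<alpha>) * carre_du_champ \<alpha> f g (x / A)"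
    unfolding integral_mult_right_zero carre_du_champ_def by (rule p)
  finally show ?thesis .
qed

section \<open>The weight\<close>

text \<open>Up to a constant, the square root of \<open>|\<phi>'|\<close>.\<close>

definition weight :: "real \<Rightarrow> real \<Rightarrow> real" where
  "weight \<alpha> y = (1 + y\<^sup>2) powr (- (1 + \<alpha>) / 4)"

lemma weight_pos [simp]: "weight \<alpha> y > 0"
  using add_pos_nonneg[of 1 "y\<^sup>2"] by (simp add: weight_def)

lemma weight_square: "(weight \<alpha> y)\<^sup>2 = (1 + y\<^sup>2) powr (- (1 + \<alpha>) / 2)"
  by (simp add: weight_def power2_eq_square flip: powr_add)

lemma weight_derivs_within: "\<alpha> > 0 \<Longrightarrow> derivs_within (\<lambda>_. 1) n (weight \<alpha>)"
  using derivs_within_power_bracket[of 0 "- (1 + \<alpha>) / 4" n] by (simp add: weight_def[abs_def])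

lemma weight_measurable [measurable]: "weight \<alpha> \<in> borel_measurable borel"
  unfolding weight_def[abs_def] by measurable

context
  fixes \<alpha> :: real
  assumes \<alpha>: "0 < \<alpha>" "\<alpha> < 2"
begin

text \<open>Outside \<open>[-1, 1]\<close> the square of the weight is at most the kernel.\<close>

lemma weight_square_integrable: "integrable lborel (\<lambda>y. (weight \<alpha> y)\<^sup>2)"
proof (rule Bochner_Integration.integrable_bound)
  show "integrable lborel (\<lambda>y. indicator {- 1..1} y + min 1 (y\<^sup>2) * frac_kernel \<alpha> y)"
    by (intro Bochner_Integration.integrable_add integrable_truncated_kernel \<alpha> integrable_real_indicator) auto
  have "(weight \<alpha> y)\<^sup>2 \<le> indicator {- 1..1} y + min 1 (y\<^sup>2) * frac_kernel \<alpha> y" for y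
  proof (cases "\<bar>y\<bar> \<le> 1")
    case True
    have "(1 + y\<^sup>2) powr (- (1 + \<alpha>) / 2) \<le> 1 powr (- (1 + \<alpha>) / 2)"
      using \<alpha> by (intro powr_mono2') auto
    then show ?thesis using True by (auto simp: weight_square abs_le_iff indicator_def intro!: add_increasing2)
  next
    case False
    have "(1 + y\<^sup>2) powr (- (1 + \<alpha>) / 2) \<le> (\<bar>y\<bar> powr 2) powr (- (1 + \<alpha>) / 2)"
      using \<alpha> False by (intro powr_mono2') auto
    also have "\<dots> = frac_kernel \<alpha> y" unfolding powr_powr frac_kernel_def by (simp add: diff_divide_distrib)
    finally show ?thesis
      using False abs_square_le_1[of y] by (auto simp: weight_square indicator_def)
  qed
  then show "AE y in lborel. norm ((weight \<alpha> y)\<^sup>2) \<le> norm (indicator {- 1..1} y + min 1 (y\<^sup>2) * frac_kernel \<alpha> y)"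
    by (auto intro!: AE_I2)
qed measurable

text \<open>The squared weight and the kernel have the same rate of decay \<open>1 + \<alpha>\<close>. If \<open>x\<close> is large then \<open>z\<close> or
\<open>z - x\<close> is comparably large, so one of the two factors on the left is bounded by a multiple of the squared
weight at \<open>x\<close>, and the other factor remains available for integration in \<open>z\<close>.\<close>

lemma weight_square_kernel_le:
  "(weight \<alpha> z)\<^sup>2 * frac_kernel \<alpha> (z - x) \<le>
     4 powr ((1 + \<alpha>) / 2) * (weight \<alpha> x)\<^sup>2 * (frac_kernel \<alpha> (z - x) + (weight \<alpha> z)\<^sup>2)"
proof -
  let ?C = "4 powr ((1 + \<alpha>) / 2)"
  have p: "t powr (- (1 + \<alpha>) / 2) \<le> ?C * (weight \<alpha> x)\<^sup>2" if t: "1 + x\<^sup>2 \<le> 4 * t" for t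
  proof -
    have "0 < 1 + x\<^sup>2" by (simp add: add_pos_nonneg)
    then have "(4 * t) powr (- (1 + \<alpha>) / 2) \<le> (weight \<alpha> x)\<^sup>2"
      unfolding weight_square using t \<alpha> by (intro powr_mono2') auto
    then have "?C * (4 * t) powr (- (1 + \<alpha>) / 2) \<le> ?C * (weight \<alpha> x)\<^sup>2"
      by (intro mult_left_mono) auto
    moreover have "(4 * t) powr (- (1 + \<alpha>) / 2) = 4 powr (- (1 + \<alpha>) / 2) * t powr (- (1 + \<alpha>) / 2)"
      using t \<open>0 < 1 + x\<^sup>2\<close> by (intro powr_mult)
    moreover have "?C * (4 powr (- (1 + \<alpha>) / 2) * s) = s" for s
      unfolding mult.assoc[symmetric] powr_add[symmetric] by (simp add: field_simps)
    ultimately show ?thesis by metis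
  qed
  have "1 + x\<^sup>2 \<le> 2 * (1 + z\<^sup>2) + 2 * (z - x)\<^sup>2"
    using zero_le_power2[of "2 * z - x"] by (simp add: power2_eq_square algebra_simps)
  then consider "1 + x\<^sup>2 \<le> 4 * (1 + z\<^sup>2)" | "1 + x\<^sup>2 \<le> 4 * (z - x)\<^sup>2" by linarith
  then show ?thesis
  proof cases
    case 1
    have "(weight \<alpha> z)\<^sup>2 * frac_kernel \<alpha> (z - x) \<le> ?C * (weight \<alpha> x)\<^sup>2 * frac_kernel \<alpha> (z - x)"
      using p[OF 1] by (intro mult_right_mono) (auto simp: weight_square)
    then show ?thesis by (simp add: algebra_simps add_increasing2)
  next
    case 2
    have "frac_kernel \<alpha> (z - x) = ((z - x)\<^sup>2) powr (- (1 + \<alpha>) / 2)"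
    proof -
      have "((z - x)\<^sup>2) powr (- (1 + \<alpha>) / 2) = (\<bar>z - x\<bar> powr 2) powr (- (1 + \<alpha>) / 2)"
        by (cases "z = x") auto
      then show ?thesis unfolding powr_powr frac_kernel_def by (simp add: diff_divide_distrib)
    qed
    then have "(weight \<alpha> z)\<^sup>2 * frac_kernel \<alpha> (z - x) \<le> (weight \<alpha> z)\<^sup>2 * (?C * (weight \<alpha> x)\<^sup>2)"
      using p[OF 2] by (intro mult_left_mono) auto
    then show ?thesis by (simp add: algebra_simps add_increasing)
  qed
qed

text \<open>If \<open>|z - x| \<le> 1\<close> then \<open>1 + x\<^sup>2 \<le> 3 (1 + z\<^sup>2)\<close>.\<close>

lemma weight_comparable:
  assumes "\<bar>z - x\<bar> \<le> 1"
  shows "weight \<alpha> z \<le> 3 powr ((1 + \<alpha>) / 4) * weight \<alpha> x"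
proof -
  have "(z - x)\<^sup>2 \<le> 1" using assms by (simp add: abs_square_le_1)
  then have "1 + x\<^sup>2 \<le> 3 + 2 * z\<^sup>2"
    using zero_le_power2[of "2 * z - x"] by (simp add: power2_eq_square algebra_simps)
  also have "\<dots> \<le> 3 * (1 + z\<^sup>2)" by simp
  finally have le: "1 + x\<^sup>2 \<le> 3 * (1 + z\<^sup>2)" .
  have pos: "0 < 1 + x\<^sup>2" by (simp add: add_pos_nonneg)
  have "(3 * (1 + z\<^sup>2)) powr (- (1 + \<alpha>) / 4) \<le> weight \<alpha> x"
    unfolding weight_def using le pos \<alpha> by (intro powr_mono2') auto
  then have "3 powr ((1 + \<alpha>) / 4) * (3 * (1 + z\<^sup>2)) powr (- (1 + \<alpha>) / 4) \<le> 3 powr ((1 + \<alpha>) / 4) * weight \<alpha> x"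
    by (intro mult_left_mono) auto
  moreover have "(3 * (1 + z\<^sup>2)) powr (- (1 + \<alpha>) / 4) = 3 powr (- (1 + \<alpha>) / 4) * weight \<alpha> z"
    unfolding weight_def by (intro powr_mult)
  moreover have "3 powr ((1 + \<alpha>) / 4) * (3 powr (- (1 + \<alpha>) / 4) * s) = s" for s :: real
    unfolding mult.assoc[symmetric] powr_add[symmetric] by (simp add: field_simps)
  ultimately show ?thesis by metis
qed

text \<open>Differentiating \<open>(1 + z\<^sup>2) powr p\<close> once or twice produces factors such as \<open>z / (1 + z\<^sup>2)\<close>, which are
bounded by \<open>1\<close>.\<close>

lemma weight_deriv_bounds:
  obtains w' w'' C where "\<And>z. (weight \<alpha> has_real_derivative w' z) (at z)"
    "\<And>z. (w' has_real_derivative w'' z) (at z)"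
    "\<And>z. \<bar>w' z\<bar> \<le> C * weight \<alpha> z" "\<And>z. \<bar>w'' z\<bar> \<le> C * weight \<alpha> z" "C \<ge> 0"
proof -
  define p where "p = - (1 + \<alpha>) / 4"
  define b :: "real \<Rightarrow> real" where "b z = 1 + z\<^sup>2" for z
  have pos: "b z > 0" for z by (simp add: b_def add_pos_nonneg)
  define w' where "w' z = 2 * p * (z * b z powr (p - 1))" for z
  define w'' where "w'' z = 2 * p * (b z powr (p - 1) + z * (2 * (p - 1) * (z * b z powr (p - 2))))" for z
  have db: "((\<lambda>z. b z powr q) has_real_derivative 2 * q * (z * b z powr (q - 1))) (at z)" for q z
    using pos[of z] unfolding b_def
    by (auto intro!: derivative_eq_intros simp: powr_diff)
  have "(weight \<alpha> has_real_derivative w' z) (at z)" for z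
    using db[of p z] by (simp add: weight_def[abs_def] b_def p_def w'_def)
  moreover have "(w' has_real_derivative w'' z) (at z)" for z
    unfolding w'_def[abs_def] w''_def using DERIV_cmult[OF DERIV_mult[OF DERIV_ident db[of "p - 1" z]], of "2 * p"]
    by (simp add: mult_ac add_ac)
  moreover have pw: "b z powr (p - 1) = weight \<alpha> z / b z" "b z powr (p - 2) = weight \<alpha> z / (b z)\<^sup>2" for z
    using pos[of z] by (simp_all add: powr_diff weight_def b_def p_def)
  have z1: "\<bar>z\<bar> / b z \<le> 1" "z\<^sup>2 / (b z)\<^sup>2 \<le> 1" "1 / b z \<le> 1" for z
  proof -
    show "\<bar>z\<bar> / b z \<le> 1"
      using pos[of z] zero_le_power2[of "\<bar>z\<bar> - 1"] by (simp add: b_def power2_eq_square algebra_simps)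
    show "1 / b z \<le> 1" using pos[of z] by (simp add: b_def)
    have "z\<^sup>2 * 1 \<le> b z * b z" by (intro mult_mono) (auto simp: b_def)
    then show "z\<^sup>2 / (b z)\<^sup>2 \<le> 1" using pos[of z] by (simp add: power2_eq_square)
  qed
  let ?C = "2 * \<bar>p\<bar> + 4 * \<bar>p\<bar> * \<bar>p - 1\<bar>"
  have "\<bar>w' z\<bar> \<le> ?C * weight \<alpha> z" for z
  proof -
    have "\<bar>w' z\<bar> = 2 * \<bar>p\<bar> * weight \<alpha> z * (\<bar>z\<bar> / b z)"
      using pos[of z] by (simp add: w'_def pw abs_mult less_imp_le)
    also have "\<dots> \<le> 2 * \<bar>p\<bar> * weight \<alpha> z * 1"
      by (intro mult_left_mono z1) (auto simp: less_imp_le)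
    also have "\<dots> \<le> ?C * weight \<alpha> z" by (simp add: algebra_simps less_imp_le)
    finally show ?thesis .
  qed
  moreover have "\<bar>w'' z\<bar> \<le> ?C * weight \<alpha> z" for z
  proof -
    have "w'' z = 2 * p * weight \<alpha> z * (1 / b z) + 4 * p * (p - 1) * weight \<alpha> z * (z\<^sup>2 / (b z)\<^sup>2)"
      by (simp add: w''_def pw power2_eq_square algebra_simps diff_divide_distrib)
    also have "\<bar>\<dots>\<bar> \<le> 2 * \<bar>p\<bar> * weight \<alpha> z * (1 / b z) + 4 * \<bar>p\<bar> * \<bar>p - 1\<bar> * weight \<alpha> z * (z\<^sup>2 / (b z)\<^sup>2)"
      using pos[of z] by (intro order_trans[OF abs_triangle_ineq]) (simp add: abs_mult less_imp_le)
    also have "\<dots> \<le> 2 * \<bar>p\<bar> * weight \<alpha> z * 1 + 4 * \<bar>p\<bar> * \<bar>p - 1\<bar> * weight \<alpha> z * 1"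
      by (intro add_mono mult_left_mono z1) (auto simp: less_imp_le)
    finally show ?thesis by (simp add: algebra_simps)
  qed
  moreover have "?C \<ge> 0" by simp
  ultimately show thesis by (rule that)
qed

text \<open>For steps \<open>|h| \<le> 1\<close> the mean value theorem applies with a derivative comparable to the weight at \<open>x\<close>; for
larger steps the two values are estimated separately with \<open>weight_square_kernel_le\<close>. The right-hand side
is integrable in \<open>h\<close>, uniformly in \<open>x\<close>.\<close>

lemma weight_diff_domination:
  "\<exists>C\<ge>0. \<forall>x h. (weight \<alpha> x - weight \<alpha> (x + h))\<^sup>2 * frac_kernel \<alpha> h \<le>
      C * (weight \<alpha> x)\<^sup>2 * (min 1 (h\<^sup>2) * frac_kernel \<alpha> h + (weight \<alpha> (x + h))\<^sup>2)"
proof -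
  obtain w' w'' C where w': "\<And>z. (weight \<alpha> has_real_derivative w' z) (at z)"
    and C: "\<And>z. \<bar>w' z\<bar> \<le> C * weight \<alpha> z" "C \<ge> 0"
    using weight_deriv_bounds by metis
  let ?T = "3 powr ((1 + \<alpha>) / 4)" and ?F = "4 powr ((1 + \<alpha>) / 2)"
  let ?D = "(C * ?T)\<^sup>2 + 1 + ?F"
  have "(weight \<alpha> x - weight \<alpha> (x + h))\<^sup>2 * frac_kernel \<alpha> h \<le>
      ?D * (weight \<alpha> x)\<^sup>2 * (min 1 (h\<^sup>2) * frac_kernel \<alpha> h + (weight \<alpha> (x + h))\<^sup>2)" for x h
  proof (cases "\<bar>h\<bar> \<le> 1")
    case True
    have "\<bar>weight \<alpha> x - weight \<alpha> (x + h)\<bar> \<le> (C * ?T * weight \<alpha> x) * \<bar>x - (x + h)\<bar>"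
    proof (rule diff_le_deriv_bound[OF w', of x h])
      fix z assume "\<bar>z - x\<bar> \<le> \<bar>h\<bar>"
      then have "C * weight \<alpha> z \<le> C * (?T * weight \<alpha> x)"
        using True C(2) by (intro mult_left_mono weight_comparable) auto
      then show "\<bar>w' z\<bar> \<le> C * ?T * weight \<alpha> x" using C(1)[of z] by simp
    qed auto
    then have "(weight \<alpha> x - weight \<alpha> (x + h))\<^sup>2 \<le> ((C * ?T * weight \<alpha> x) * \<bar>h\<bar>)\<^sup>2"
      by (intro power2_le_iff_abs_le[THEN iffD2]) (use C(2) in \<open>auto simp: less_imp_le\<close>)
    also have "\<dots> = (C * ?T)\<^sup>2 * (weight \<alpha> x)\<^sup>2 * min 1 (h\<^sup>2)"
      using True abs_square_le_1[of h] by (simp add: power_mult_distrib)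
    finally have "(weight \<alpha> x - weight \<alpha> (x + h))\<^sup>2 * frac_kernel \<alpha> h \<le>
        (C * ?T)\<^sup>2 * (weight \<alpha> x)\<^sup>2 * min 1 (h\<^sup>2) * frac_kernel \<alpha> h"
      by (intro mult_right_mono) auto
    also have "\<dots> = (C * ?T)\<^sup>2 * (weight \<alpha> x)\<^sup>2 * (min 1 (h\<^sup>2) * frac_kernel \<alpha> h)" by simp
    also have "\<dots> \<le> ?D * (weight \<alpha> x)\<^sup>2 * (min 1 (h\<^sup>2) * frac_kernel \<alpha> h + (weight \<alpha> (x + h))\<^sup>2)"
      by (intro mult_mono) auto
    finally show ?thesis .
  next
    case False
    then have m: "min 1 (h\<^sup>2) = 1" using abs_square_le_1[of h] by simp
    have "(weight \<alpha> x - weight \<alpha> (x + h))\<^sup>2 \<le> (weight \<alpha> x)\<^sup>2 + (weight \<alpha> (x + h))\<^sup>2"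
      by (simp add: power2_diff less_imp_le)
    then have "(weight \<alpha> x - weight \<alpha> (x + h))\<^sup>2 * frac_kernel \<alpha> h \<le>
        (weight \<alpha> x)\<^sup>2 * frac_kernel \<alpha> h + (weight \<alpha> (x + h))\<^sup>2 * frac_kernel \<alpha> h"
      by (simp add: mult_right_mono flip: distrib_right)
    also have "\<dots> \<le> 1 * (weight \<alpha> x)\<^sup>2 * (frac_kernel \<alpha> h + (weight \<alpha> (x + h))\<^sup>2) +
        ?F * (weight \<alpha> x)\<^sup>2 * (frac_kernel \<alpha> h + (weight \<alpha> (x + h))\<^sup>2)"
      using weight_square_kernel_le[of "x + h" x] by (intro add_mono) (auto simp: algebra_simps)
    also have "\<dots> = (1 + ?F) * ((weight \<alpha> x)\<^sup>2 * (frac_kernel \<alpha> h + (weight \<alpha> (x + h))\<^sup>2))"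
      by (simp only: distrib_right mult.assoc)
    also have "\<dots> \<le> ?D * ((weight \<alpha> x)\<^sup>2 * (frac_kernel \<alpha> h + (weight \<alpha> (x + h))\<^sup>2))"
      by (intro mult_right_mono) auto
    finally show ?thesis unfolding m by (simp only: mult.assoc mult_1_left)
  qed
  moreover have "?D \<ge> 0" by simp
  ultimately show ?thesis by blast
qed

text \<open>The analogue of \<open>weight_square_kernel_le\<close> for the weight itself, which need not be integrable. The
arithmetic-geometric mean inequality \<open>2 w(x) w(z) \<le> w(x)\<^sup>2 + w(z)\<^sup>2\<close> reduces it to the square.\<close>

lemma weight_kernel_le:
  "2 * weight \<alpha> z * frac_kernel \<alpha> (z - x) \<le>
     (1 + 4 powr ((1 + \<alpha>) / 2)) * weight \<alpha> x * (frac_kernel \<alpha> (z - x) + (weight \<alpha> z)\<^sup>2)"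
proof -
  let ?k = "frac_kernel \<alpha> (z - x)" and ?F = "4 powr ((1 + \<alpha>) / 2)"
  let ?w = "weight \<alpha> x" and ?v = "weight \<alpha> z"
  have "?w * (2 * ?v * ?k) \<le> ?w\<^sup>2 * ?k + ?v\<^sup>2 * ?k"
    using mult_right_mono[OF sum_squares_bound[of ?w ?v], of ?k] by (simp add: algebra_simps)
  also have "\<dots> \<le> ?w\<^sup>2 * (?k + ?v\<^sup>2) + ?F * ?w\<^sup>2 * (?k + ?v\<^sup>2)"
    using weight_square_kernel_le[of z x] by (intro add_mono) (auto simp: algebra_simps)
  also have "\<dots> = ?w * ((1 + ?F) * ?w * (?k + ?v\<^sup>2))"
    by (simp add: power2_eq_square algebra_simps)
  finally show ?thesis by (rule mult_left_le_imp_le) simp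
qed

lemma weight_second_diff_domination:
  "\<exists>C\<ge>0. \<forall>x h. \<bar>second_diff (weight \<alpha>) x h\<bar> * frac_kernel \<alpha> h \<le>
      C * weight \<alpha> x * (min 1 (h\<^sup>2) * frac_kernel \<alpha> h + (weight \<alpha> (x + h))\<^sup>2 + (weight \<alpha> (x - h))\<^sup>2)"
proof -
  obtain w' w'' C where w': "\<And>z. (weight \<alpha> has_real_derivative w' z) (at z)"
    and w'': "\<And>z. (w' has_real_derivative w'' z) (at z)"
    and C: "\<And>z. \<bar>w'' z\<bar> \<le> C * weight \<alpha> z" "C \<ge> 0"
    using weight_deriv_bounds by metis
  let ?T = "3 powr ((1 + \<alpha>) / 4)" and ?F = "4 powr ((1 + \<alpha>) / 2)"
  let ?D = "2 * (C * ?T) + 3 + ?F"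
  have "\<bar>second_diff (weight \<alpha>) x h\<bar> * frac_kernel \<alpha> h \<le>
      ?D * weight \<alpha> x * (min 1 (h\<^sup>2) * frac_kernel \<alpha> h + (weight \<alpha> (x + h))\<^sup>2 + (weight \<alpha> (x - h))\<^sup>2)" for x h
  proof (cases "\<bar>h\<bar> \<le> 1")
    case True
    have "\<bar>second_diff (weight \<alpha>) x h\<bar> \<le> 2 * (C * ?T * weight \<alpha> x) * h\<^sup>2"
    proof (rule second_diff_le_deriv_bound[OF w' w''])
      fix z assume "\<bar>z - x\<bar> \<le> \<bar>h\<bar>"
      then have "C * weight \<alpha> z \<le> C * (?T * weight \<alpha> x)"
        using True C(2) by (intro mult_left_mono weight_comparable) auto
      then show "\<bar>w'' z\<bar> \<le> C * ?T * weight \<alpha> x" using C(1)[of z] by simp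
    qed
    also have "\<dots> = 2 * (C * ?T) * weight \<alpha> x * min 1 (h\<^sup>2)"
      using True abs_square_le_1[of h] by simp
    finally have "\<bar>second_diff (weight \<alpha>) x h\<bar> * frac_kernel \<alpha> h \<le>
        2 * (C * ?T) * weight \<alpha> x * min 1 (h\<^sup>2) * frac_kernel \<alpha> h"
      by (intro mult_right_mono) auto
    also have "\<dots> = 2 * (C * ?T) * weight \<alpha> x * (min 1 (h\<^sup>2) * frac_kernel \<alpha> h)" by simp
    also have "\<dots> \<le> ?D * weight \<alpha> x *
        (min 1 (h\<^sup>2) * frac_kernel \<alpha> h + (weight \<alpha> (x + h))\<^sup>2 + (weight \<alpha> (x - h))\<^sup>2)"
      by (intro mult_mono) (use C(2) in \<open>auto simp: less_imp_le add.assoc\<close>)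
    finally show ?thesis .
  next
    case False
    then have m: "min 1 (h\<^sup>2) = 1" using abs_square_le_1[of h] by simp
    let ?k = "frac_kernel \<alpha> h" and ?w = "weight \<alpha> x" and ?a = "weight \<alpha> (x + h)" and ?b = "weight \<alpha> (x - h)"
    have "\<bar>second_diff (weight \<alpha>) x h\<bar> \<le> 2 * ?w + ?a + ?b"
      using weight_pos[of \<alpha> x] weight_pos[of \<alpha> "x + h"] weight_pos[of \<alpha> "x - h"]
      unfolding second_diff_def by linarith
    then have "\<bar>second_diff (weight \<alpha>) x h\<bar> * ?k \<le> (2 * ?w + ?a + ?b) * ?k"
      by (intro mult_right_mono) auto
    also have "\<dots> = 2 * ?w * ?k + 2 * ?a * ?k / 2 + 2 * ?b * ?k / 2" by (simp add: algebra_simps)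
    also have "\<dots> \<le> 2 * ?w * (?k + ?a\<^sup>2 + ?b\<^sup>2) + (1 + ?F) * ?w * (?k + ?a\<^sup>2 + ?b\<^sup>2) / 2
        + (1 + ?F) * ?w * (?k + ?a\<^sup>2 + ?b\<^sup>2) / 2"
    proof (intro add_mono divide_right_mono)
      have "2 * ?a * ?k \<le> (1 + ?F) * ?w * (?k + ?a\<^sup>2)" "2 * ?b * ?k \<le> (1 + ?F) * ?w * (?k + ?b\<^sup>2)"
        using weight_kernel_le[of "x + h" x] weight_kernel_le[of "x - h" x] by simp_all
      moreover have "(1 + ?F) * ?w * (?k + ?a\<^sup>2) \<le> (1 + ?F) * ?w * (?k + ?a\<^sup>2 + ?b\<^sup>2)"
        "(1 + ?F) * ?w * (?k + ?b\<^sup>2) \<le> (1 + ?F) * ?w * (?k + ?a\<^sup>2 + ?b\<^sup>2)"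
        "2 * ?w * ?k \<le> 2 * ?w * (?k + ?a\<^sup>2 + ?b\<^sup>2)"
        by (intro mult_left_mono; simp add: less_imp_le add.assoc)+
      ultimately show "2 * ?a * ?k \<le> (1 + ?F) * ?w * (?k + ?a\<^sup>2 + ?b\<^sup>2)"
        "2 * ?b * ?k \<le> (1 + ?F) * ?w * (?k + ?a\<^sup>2 + ?b\<^sup>2)"
        "2 * ?w * ?k \<le> 2 * ?w * (?k + ?a\<^sup>2 + ?b\<^sup>2)"
        by linarith+
    qed auto
    also have "\<dots> = (3 + ?F) * (?w * (?k + ?a\<^sup>2 + ?b\<^sup>2))" by (simp add: algebra_simps)
    also have "\<dots> \<le> ?D * (?w * (?k + ?a\<^sup>2 + ?b\<^sup>2))"
      using C(2) by (intro mult_right_mono) (auto simp: less_imp_le)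
    finally show ?thesis unfolding m by (simp add: mult.assoc)
  qed
  moreover have "?D \<ge> 0" using C(2) by simp
  ultimately show ?thesis by blast
qed

text \<open>The squared weight has a finite integral, and this integral does not change when the weight is translated to
\<open>x\<close>; so the domination integrates to a bound with a constant independent of \<open>x\<close>.\<close>

lemma weight_carre_bound: "\<exists>C\<ge>0. \<forall>x. carre_du_champ \<alpha> (weight \<alpha>) (weight \<alpha>) x \<le> C * (weight \<alpha> x)\<^sup>2"
proof -
  obtain C where C: "C \<ge> 0" "\<And>x h. (weight \<alpha> x - weight \<alpha> (x + h))\<^sup>2 * frac_kernel \<alpha> h \<le>
      C * (weight \<alpha> x)\<^sup>2 * (min 1 (h\<^sup>2) * frac_kernel \<alpha> h + (weight \<alpha> (x + h))\<^sup>2)"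
    using weight_diff_domination by blast
  let ?m = "LINT h|lborel. min 1 (h\<^sup>2) * frac_kernel \<alpha> h" and ?I = "LINT h|lborel. (weight \<alpha> h)\<^sup>2"
  have t: "integrable lborel (\<lambda>h. (weight \<alpha> (x + h))\<^sup>2)" "(LINT h|lborel. (weight \<alpha> (x + h))\<^sup>2) = ?I" for x
    using lborel_integrable_real_affine[OF weight_square_integrable, of 1 x]
      lborel_integral_real_affine[of 1 "\<lambda>h. (weight \<alpha> h)\<^sup>2" x] by simp_all
  have "carre_du_champ \<alpha> (weight \<alpha>) (weight \<alpha>) x \<le> (C * (?m + ?I)) * (weight \<alpha> x)\<^sup>2" for x
  proof -
    have "carre_du_champ \<alpha> (weight \<alpha>) (weight \<alpha>) x \<le>
        (LINT h|lborel. C * (weight \<alpha> x)\<^sup>2 * (min 1 (h\<^sup>2) * frac_kernel \<alpha> h + (weight \<alpha> (x + h))\<^sup>2))"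
      unfolding carre_du_champ_def
    proof (rule integral_mono)
      show "integrable lborel (\<lambda>h. (weight \<alpha> x - weight \<alpha> (x + h)) * (weight \<alpha> x - weight \<alpha> (x + h)) * frac_kernel \<alpha> h)"
        by (intro integrable_carre weight_derivs_within \<alpha>)
      show "integrable lborel (\<lambda>h. C * (weight \<alpha> x)\<^sup>2 * (min 1 (h\<^sup>2) * frac_kernel \<alpha> h + (weight \<alpha> (x + h))\<^sup>2))"
        by (intro integrable_mult_right Bochner_Integration.integrable_add integrable_truncated_kernel t \<alpha>)
    qed (use C(2)[of x] in \<open>simp add: power2_eq_square\<close>)
    also have "\<dots> = (C * (?m + ?I)) * (weight \<alpha> x)\<^sup>2"
      using t integrable_truncated_kernel[OF \<alpha>] by simp
    finally show ?thesis .
  qed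
  moreover have "C * (?m + ?I) \<ge> 0"
    using C(1) by (intro mult_nonneg_nonneg add_nonneg_nonneg integral_nonneg_AE AE_I2) auto
  ultimately show ?thesis by blast
qed

lemma weight_singular_frac_bound: "\<exists>C\<ge>0. \<forall>x. \<bar>singular_frac \<alpha> (weight \<alpha>) x\<bar> \<le> C * weight \<alpha> x"
proof -
  obtain C where C: "C \<ge> 0" "\<And>x h. \<bar>second_diff (weight \<alpha>) x h\<bar> * frac_kernel \<alpha> h \<le>
      C * weight \<alpha> x * (min 1 (h\<^sup>2) * frac_kernel \<alpha> h + (weight \<alpha> (x + h))\<^sup>2 + (weight \<alpha> (x - h))\<^sup>2)"
    using weight_second_diff_domination by blast
  let ?m = "LINT h|lborel. min 1 (h\<^sup>2) * frac_kernel \<alpha> h" and ?I = "LINT h|lborel. (weight \<alpha> h)\<^sup>2"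
  have t: "integrable lborel (\<lambda>h. (weight \<alpha> (x + h))\<^sup>2)" "(LINT h|lborel. (weight \<alpha> (x + h))\<^sup>2) = ?I"
    "integrable lborel (\<lambda>h. (weight \<alpha> (x - h))\<^sup>2)" "(LINT h|lborel. (weight \<alpha> (x - h))\<^sup>2) = ?I" for x
    using lborel_integrable_real_affine[OF weight_square_integrable, of 1 x]
      lborel_integral_real_affine[of 1 "\<lambda>h. (weight \<alpha> h)\<^sup>2" x]
      lborel_integrable_real_affine[OF weight_square_integrable, of "- 1" x]
      lborel_integral_real_affine[of "- 1" "\<lambda>h. (weight \<alpha> h)\<^sup>2" x] by simp_all
  have "\<bar>singular_frac \<alpha> (weight \<alpha>) x\<bar> \<le> (C * (?m + ?I + ?I)) * weight \<alpha> x" for x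
  proof -
    have "norm (singular_frac \<alpha> (weight \<alpha>) x) \<le>
        (LINT h|lborel. C * weight \<alpha> x *
          (min 1 (h\<^sup>2) * frac_kernel \<alpha> h + (weight \<alpha> (x + h))\<^sup>2 + (weight \<alpha> (x - h))\<^sup>2))"
      unfolding singular_frac_def
    proof (rule Bochner_Integration.integral_norm_bound_integral)
      show "integrable lborel (\<lambda>h. second_diff (weight \<alpha>) x h * frac_kernel \<alpha> h)"
        by (intro integrable_second_diff weight_derivs_within \<alpha>)
      show "integrable lborel (\<lambda>h. C * weight \<alpha> x *
          (min 1 (h\<^sup>2) * frac_kernel \<alpha> h + (weight \<alpha> (x + h))\<^sup>2 + (weight \<alpha> (x - h))\<^sup>2))"
        by (intro integrable_mult_right Bochner_Integration.integrable_add integrable_truncated_kernel t \<alpha>)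
    qed (use C(2)[of x] in \<open>simp add: abs_mult\<close>)
    also have "\<dots> = (C * (?m + ?I + ?I)) * weight \<alpha> x"
      using t integrable_truncated_kernel[OF \<alpha>] by simp
    finally show ?thesis by simp
  qed
  moreover have "C * (?m + ?I + ?I) \<ge> 0"
    using C(1) by (intro mult_nonneg_nonneg add_nonneg_nonneg integral_nonneg_AE AE_I2) auto
  ultimately show ?thesis by blast
qed

end

section \<open>The commutator estimate\<close>

text \<open>The commutator equals \<open>u L W - 2 \<Gamma>(u, W)\<close>. The first term is small of order \<open>-\<alpha>\<close> in \<open>A\<close>. In the second,
\<open>carre_young\<close> is applied with factors proportional to \<open>A powr (- \<alpha> / 4)\<close> and \<open>A powr (\<alpha> / 4)\<close>: the gain
\<open>A powr (- \<alpha>)\<close> of \<open>\<Gamma>(W, W)\<close> is shared equally between the two terms of the upper bound.\<close>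

lemma commutator_pointwise_bound:
  fixes \<alpha> A :: real
  assumes \<alpha>: "0 < \<alpha>" "\<alpha> < 2" and A: "A > 1"
    and u: "derivs_within (\<lambda>x. inverse (1 + x\<^sup>2)) 4 u"
    and E: "\<And>x. carre_du_champ \<alpha> (weight \<alpha>) (weight \<alpha>) x \<le> E * (weight \<alpha> x)\<^sup>2" "E \<ge> 0"
    and L: "\<And>x. \<bar>singular_frac \<alpha> (weight \<alpha>) x\<bar> \<le> L * weight \<alpha> x" "L \<ge> 0"
  defines "W \<equiv> \<lambda>x. weight \<alpha> (x / A)"
  shows "symbol_const \<alpha> * \<bar>(abs_D \<alpha> (\<lambda>y. u y * W y) x - abs_D \<alpha> u x * W x) * (abs_D \<alpha> u x * W x)\<bar> \<le>
     A powr (- (\<alpha> / 2)) * ((L + E) * ((u x)\<^sup>2 + (abs_D \<alpha> u x)\<^sup>2) + carre_du_champ \<alpha> u u x) * (W x)\<^sup>2"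
proof -
  let ?p = "abs_D \<alpha> u x" and ?K = "symbol_const \<alpha>"
  have A0: "A > 0" using A by simp
  have Wp: "W x > 0" for x by (simp add: W_def)
  have Wd: "derivs_within (\<lambda>_. 1) n W" for n
    unfolding W_def using \<alpha> A by (intro derivs_within_dilate weight_derivs_within) auto
  have u4: "derivs_within (\<lambda>_. 1) 4 u" using u by (rule derivs_within_unweighted)
  have u2: "derivs_within (\<lambda>_. 1) 2 u"
    using u4 by (rule derivs_within_mono) simp
  have u1: "derivs_within (\<lambda>_. 1) 1 u" using u2 by (rule derivs_within_mono) simp
  have K: "?K > 0" by (rule symbol_const_pos[OF \<alpha>])
  have Apow: "A powr (- \<alpha>) \<le> A powr (- (\<alpha> / 2))" using A \<alpha> by (intro powr_mono) auto
  have LW: "\<bar>singular_frac \<alpha> W x\<bar> \<le> A powr (- \<alpha>) * (L * W x)"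
    unfolding W_def singular_frac_dilate[OF A0] using L(1)[of "x / A"] by (simp add: abs_mult mult_left_mono)
  have EW: "carre_du_champ \<alpha> W W x \<le> A powr (- \<alpha>) * (E * (W x)\<^sup>2)"
    unfolding W_def carre_dilate[OF A0] using E(1)[of "x / A"] by (simp add: mult_left_mono)
  have "?K * (abs_D \<alpha> (\<lambda>y. u y * W y) x - ?p * W x) =
      singular_frac \<alpha> (\<lambda>y. u y * W y) x - W x * singular_frac \<alpha> u x"
    using abs_D_eq_singular_frac[OF derivs_within_mult[OF u Wd] \<alpha>, of x] abs_D_eq_singular_frac[OF u \<alpha>, of x]
    by (simp add: algebra_simps)
  also have "\<dots> = u x * singular_frac \<alpha> W x - 2 * carre_du_champ \<alpha> u W x"
    using singular_frac_mult[OF \<alpha> u2 Wd] by simp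
  finally have comm: "?K * (abs_D \<alpha> (\<lambda>y. u y * W y) x - ?p * W x) =
      u x * singular_frac \<alpha> W x - 2 * carre_du_champ \<alpha> u W x" .
  have "?K * \<bar>(abs_D \<alpha> (\<lambda>y. u y * W y) x - ?p * W x) * (?p * W x)\<bar> =
      \<bar>(u x * singular_frac \<alpha> W x - 2 * carre_du_champ \<alpha> u W x) * (?p * W x)\<bar>"
    unfolding comm[symmetric] using K by (simp add: abs_mult)
  also have "\<dots> = \<bar>u x * ?p * W x * singular_frac \<alpha> W x - 2 * (W x * ?p * carre_du_champ \<alpha> u W x)\<bar>"
    by (simp add: algebra_simps)
  also have "\<dots> \<le> \<bar>u x * ?p * W x * singular_frac \<alpha> W x\<bar> + \<bar>2 * (W x * ?p * carre_du_champ \<alpha> u W x)\<bar>"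
    by (rule abs_triangle_ineq4)
  also have "\<dots> = \<bar>u x\<bar> * \<bar>?p\<bar> * W x * \<bar>singular_frac \<alpha> W x\<bar> + 2 * \<bar>W x * ?p * carre_du_champ \<alpha> u W x\<bar>"
    using Wp[of x] by (simp add: abs_mult)
  also have "\<dots> \<le> A powr (- (\<alpha> / 2)) * L * ((u x)\<^sup>2 + ?p\<^sup>2) * (W x)\<^sup>2 +
      A powr (- (\<alpha> / 2)) * (carre_du_champ \<alpha> u u x + E * ?p\<^sup>2) * (W x)\<^sup>2"
  proof (rule add_mono)
    have "\<bar>u x\<bar> * \<bar>?p\<bar> * W x * \<bar>singular_frac \<alpha> W x\<bar> \<le> \<bar>u x\<bar> * \<bar>?p\<bar> * W x * (A powr (- \<alpha>) * (L * W x))"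
      using Wp[of x] by (intro mult_left_mono LW) auto
    also have "\<dots> = A powr (- \<alpha>) * (L * (W x)\<^sup>2) * (\<bar>u x\<bar> * \<bar>?p\<bar>)" by (simp add: power2_eq_square)
    also have "\<dots> \<le> A powr (- (\<alpha> / 2)) * (L * (W x)\<^sup>2) * ((u x)\<^sup>2 + ?p\<^sup>2)"
    proof (intro mult_mono Apow)
      have "0 \<le> \<bar>u x\<bar> * \<bar>?p\<bar>" by simp
      then show "\<bar>u x\<bar> * \<bar>?p\<bar> \<le> (u x)\<^sup>2 + ?p\<^sup>2"
        using sum_squares_bound[of "\<bar>u x\<bar>" "\<bar>?p\<bar>"] by (simp only: power2_abs mult.assoc)
    qed (use L(2) in auto)
    finally show "\<bar>u x\<bar> * \<bar>?p\<bar> * W x * \<bar>singular_frac \<alpha> W x\<bar> \<le>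
        A powr (- (\<alpha> / 2)) * L * ((u x)\<^sup>2 + ?p\<^sup>2) * (W x)\<^sup>2" by (simp add: mult_ac)
    let ?c = "A powr (- (\<alpha> / 4)) * W x" and ?d = "A powr (\<alpha> / 4) * ?p"
    have cd: "?c * ?d = W x * ?p"
      using A0 by (simp add: powr_minus field_simps)
    have c2: "?c\<^sup>2 = A powr (- (\<alpha> / 2)) * (W x)\<^sup>2" and d2: "?d\<^sup>2 = A powr (\<alpha> / 2) * ?p\<^sup>2"
      using A0 by (simp_all add: power_mult_distrib power2_eq_square[of "A powr _"] flip: powr_add)
    \<comment> \<open>The loss in \<open>?d\<close> uses up half of the gain from the dilation of the weight.\<close>
    have half: "A powr (\<alpha> / 2) * A powr (- \<alpha>) = A powr (- (\<alpha> / 2))"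
      by (simp flip: powr_add)
    have "2 * \<bar>W x * ?p * carre_du_champ \<alpha> u W x\<bar> \<le> ?c\<^sup>2 * carre_du_champ \<alpha> u u x + ?d\<^sup>2 * carre_du_champ \<alpha> W W x"
      using carre_young[OF \<alpha> u1 Wd, of ?c ?d x] unfolding cd .
    also have "\<dots> \<le> A powr (- (\<alpha> / 2)) * (W x)\<^sup>2 * carre_du_champ \<alpha> u u x +
        A powr (\<alpha> / 2) * ?p\<^sup>2 * (A powr (- \<alpha>) * (E * (W x)\<^sup>2))"
      unfolding c2 d2 by (intro add_mono mult_left_mono EW) auto
    also have "A powr (\<alpha> / 2) * ?p\<^sup>2 * (A powr (- \<alpha>) * (E * (W x)\<^sup>2)) =
        (A powr (\<alpha> / 2) * A powr (- \<alpha>)) * (?p\<^sup>2 * (E * (W x)\<^sup>2))" by (simp only: mult_ac)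
    finally show "2 * \<bar>W x * ?p * carre_du_champ \<alpha> u W x\<bar> \<le>
        A powr (- (\<alpha> / 2)) * (carre_du_champ \<alpha> u u x + E * ?p\<^sup>2) * (W x)\<^sup>2"
      unfolding half by (simp add: algebra_simps)
  qed
  also have "\<dots> \<le> A powr (- (\<alpha> / 2)) * ((L + E) * ((u x)\<^sup>2 + ?p\<^sup>2) + carre_du_champ \<alpha> u u x) * (W x)\<^sup>2"
    using E(2) by (simp add: algebra_simps)
  finally show ?thesis .
qed

text \<open>The integrals of the commutator estimate contain the square of the dilated weight and converge for this
reason, although the dilated weight itself may fail to be integrable.\<close>

lemma integrable_bounded_times_weight:
  assumes \<alpha>: "0 < \<alpha>" "\<alpha> < 2" and A: "A > 0" and [measurable]: "F \<in> borel_measurable borel"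
    and F: "\<And>x. \<bar>F x\<bar> \<le> C"
  shows "integrable lborel (\<lambda>x. F x * (weight \<alpha> (x / A))\<^sup>2)"
proof (rule Bochner_Integration.integrable_bound)
  show "integrable lborel (\<lambda>x. C * (weight \<alpha> (x / A))\<^sup>2)"
    using lborel_integrable_real_affine[OF weight_square_integrable[OF \<alpha>], of "1 / A" 0] A by simp
  show "AE x in lborel. norm (F x * (weight \<alpha> (x / A))\<^sup>2) \<le> norm (C * (weight \<alpha> (x / A))\<^sup>2)"
    using F by (intro AE_I2) (auto simp: abs_mult intro!: mult_right_mono intro: order_trans[OF _ abs_ge_self])
qed measurable

text \<open>The product rule gives \<open>\<Gamma>(u, u) = u L u - L(u\<^sup>2) / 2\<close>. After integration against \<open>W\<^sup>2\<close>, symmetry lets \<open>L\<close>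
act on \<open>W\<^sup>2\<close> instead of \<open>u\<^sup>2\<close>, and by the product rule \<open>L(W\<^sup>2)\<close> is bounded by a multiple of \<open>W\<^sup>2\<close>.\<close>

lemma carre_energy_bound:
  fixes \<alpha> A :: real
  assumes \<alpha>: "0 < \<alpha>" "\<alpha> < 2" and A: "A > 1"
    and u: "derivs_within (\<lambda>x. inverse (1 + x\<^sup>2)) 4 u"
    and E: "\<And>x. carre_du_champ \<alpha> (weight \<alpha>) (weight \<alpha>) x \<le> E * (weight \<alpha> x)\<^sup>2" "E \<ge> 0"
    and L: "\<And>x. \<bar>singular_frac \<alpha> (weight \<alpha>) x\<bar> \<le> L * weight \<alpha> x" "L \<ge> 0"
  defines "W \<equiv> \<lambda>x. weight \<alpha> (x / A)"
  shows "(LINT x|lborel. carre_du_champ \<alpha> u u x * (W x)\<^sup>2) \<le>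
     (symbol_const \<alpha> + L + E) * (LINT x|lborel. ((u x)\<^sup>2 + (abs_D \<alpha> u x)\<^sup>2) * (W x)\<^sup>2)"
proof -
  let ?K = "symbol_const \<alpha>"
  have A0: "A > 0" using A by simp
  have Wd: "derivs_within (\<lambda>_. 1) n W" for n
    unfolding W_def using \<alpha> A by (intro derivs_within_dilate weight_derivs_within) auto
  have WWd: "derivs_within (\<lambda>_. 1) n (\<lambda>x. (W x)\<^sup>2)" for n
    using derivs_within_mult[OF Wd Wd] by (simp add: power2_eq_square)
  have u4: "derivs_within (\<lambda>_. 1) 4 u" using u by (rule derivs_within_unweighted)
  have u2: "derivs_within (\<lambda>_. 1) 2 u" using u4 by (rule derivs_within_mono) simp
  have uu: "derivs_within (\<lambda>x. inverse (1 + x\<^sup>2)) 4 (\<lambda>x. u x * u x)"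
    by (rule derivs_within_mult[OF u u4])
  have K: "?K > 0" by (rule symbol_const_pos[OF \<alpha>])
  note [measurable] = derivs_within_measurable[OF u]
  have [measurable]: "W \<in> borel_measurable borel" unfolding W_def by measurable
  have sm [measurable]: "singular_frac \<alpha> f \<in> borel_measurable borel" if [measurable]: "f \<in> borel_measurable borel" for f
    unfolding singular_frac_def[abs_def] second_diff_def by measurable
  obtain B where B: "\<And>x. \<bar>u x\<bar> \<le> B" using derivs_within_bound[OF u4] by auto
  obtain P where P: "\<And>x. \<bar>abs_D \<alpha> u x\<bar> \<le> P" using abs_D_bounded[OF u, of \<alpha>] \<alpha> by auto
  have B0: "0 \<le> B" using B[of 0] by linarith
  have sq: "t\<^sup>2 \<le> b\<^sup>2" if "\<bar>t\<bar> \<le> b" for t b :: real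
    using power_mono[OF that abs_ge_zero, of 2] by simp
  let ?S = "\<lambda>x. ((u x)\<^sup>2 + (abs_D \<alpha> u x)\<^sup>2) * (W x)\<^sup>2"
  have S: "integrable lborel ?S"
    unfolding W_def
    by (rule integrable_bounded_times_weight[OF \<alpha> A0, of _ "B\<^sup>2 + P\<^sup>2"])
      (auto intro!: add_mono sq B P)
  have I1: "integrable lborel (\<lambda>x. (u x * abs_D \<alpha> u x) * (W x)\<^sup>2)"
    unfolding W_def
    by (rule integrable_bounded_times_weight[OF \<alpha> A0, of _ "B * P"])
      (auto simp: abs_mult intro!: mult_mono B P B0)
  have Iu: "integrable lborel (\<lambda>x. u x * u x)" by (rule derivs_within_integrable[OF uu])
  have IW: "integrable lborel (\<lambda>x. (W x)\<^sup>2)"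
    using integrable_bounded_times_weight[OF \<alpha> A0, of "\<lambda>_. 1" 1] unfolding W_def by simp
  have LWW: "\<bar>singular_frac \<alpha> (\<lambda>x. (W x)\<^sup>2) x\<bar> \<le> 2 * (L + E) * (W x)\<^sup>2" for x
  proof -
    have Apow: "A powr (- \<alpha>) \<le> 1" using A \<alpha> powr_mono[of "- \<alpha>" 0 A] by simp
    have "\<bar>singular_frac \<alpha> W x\<bar> \<le> A powr (- \<alpha>) * (L * W x)"
      unfolding W_def singular_frac_dilate[OF A0] using L(1)[of "x / A"] by (simp add: abs_mult mult_left_mono)
    also have "\<dots> \<le> 1 * (L * W x)" using L(2) by (intro mult_right_mono Apow) (auto simp: W_def less_imp_le)
    finally have LW: "\<bar>singular_frac \<alpha> W x\<bar> \<le> L * W x" by simp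
    have "carre_du_champ \<alpha> W W x \<le> A powr (- \<alpha>) * (E * (W x)\<^sup>2)"
      unfolding W_def carre_dilate[OF A0] using E(1)[of "x / A"] by (simp add: mult_left_mono)
    also have "\<dots> \<le> 1 * (E * (W x)\<^sup>2)" using E(2) by (intro mult_right_mono Apow) auto
    finally have EW: "carre_du_champ \<alpha> W W x \<le> E * (W x)\<^sup>2" by simp
    have "W x * \<bar>singular_frac \<alpha> W x\<bar> \<le> W x * (L * W x)"
      using LW by (intro mult_left_mono) (auto simp: W_def less_imp_le)
    moreover have "\<bar>W x\<bar> = W x" by (simp add: W_def less_imp_le)
    ultimately have "\<bar>W x * singular_frac \<alpha> W x\<bar> \<le> L * (W x)\<^sup>2"
      by (simp add: abs_mult power2_eq_square mult_ac)
    moreover have "singular_frac \<alpha> (\<lambda>x. (W x)\<^sup>2) x = 2 * (W x * singular_frac \<alpha> W x) - 2 * carre_du_champ \<alpha> W W x"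
      using singular_frac_mult[OF \<alpha> Wd Wd, of x] by (simp add: power2_eq_square)
    moreover have "0 \<le> carre_du_champ \<alpha> W W x" by (rule carre_nonneg[OF \<alpha>])
    ultimately show ?thesis using EW by (simp add: distrib_right)
  qed
  have uS: "(u x * u x) * (2 * (L + E) * (W x)\<^sup>2) \<le> 2 * (L + E) * ?S x" for x
  proof -
    have "(u x * u x) * (2 * (L + E) * (W x)\<^sup>2) = 2 * (L + E) * ((u x)\<^sup>2 * (W x)\<^sup>2)"
      by (simp only: power2_eq_square mult_ac)
    also have "\<dots> \<le> 2 * (L + E) * ?S x"
      using L(2) E(2) by (intro mult_left_mono mult_right_mono) auto
    finally show ?thesis .
  qed
  have I2: "integrable lborel (\<lambda>x. u x * u x * singular_frac \<alpha> (\<lambda>x. (W x)\<^sup>2) x)"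
  proof (rule Bochner_Integration.integrable_bound)
    show "integrable lborel (\<lambda>x. 2 * (L + E) * ?S x)" using S by simp
    show "AE x in lborel. norm (u x * u x * singular_frac \<alpha> (\<lambda>x. (W x)\<^sup>2) x) \<le> norm (2 * (L + E) * ?S x)"
    proof (intro AE_I2)
      fix x
      have "norm (u x * u x * singular_frac \<alpha> (\<lambda>x. (W x)\<^sup>2) x) \<le> (u x * u x) * (2 * (L + E) * (W x)\<^sup>2)"
        using mult_left_mono[OF LWW[of x], of "u x * u x"] by (simp add: abs_mult)
      also have "\<dots> \<le> 2 * (L + E) * ?S x" by (rule uS)
      finally show "norm (u x * u x * singular_frac \<alpha> (\<lambda>x. (W x)\<^sup>2) x) \<le> norm (2 * (L + E) * ?S x)"
        unfolding real_norm_def by (rule order_trans[OF _ abs_ge_self])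
    qed
  qed measurable
  have I3: "integrable lborel (\<lambda>x. (W x)\<^sup>2 * singular_frac \<alpha> (\<lambda>x. u x * u x) x)"
  proof -
    obtain Q where Q: "\<And>x. \<bar>abs_D \<alpha> (\<lambda>x. u x * u x) x\<bar> \<le> Q" using abs_D_bounded[OF uu, of \<alpha>] \<alpha> by auto
    have "\<bar>singular_frac \<alpha> (\<lambda>x. u x * u x) x\<bar> \<le> ?K * Q" for x
      using Q[of x] K abs_D_eq_singular_frac[OF uu \<alpha>, of x]
      by (simp add: abs_mult flip: abs_D_eq_singular_frac[OF uu \<alpha>])
    then have "integrable lborel (\<lambda>x. singular_frac \<alpha> (\<lambda>x. u x * u x) x * (W x)\<^sup>2)"
      unfolding W_def by (intro integrable_bounded_times_weight[OF \<alpha> A0]) auto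
    then show ?thesis by (simp add: mult.commute)
  qed
  have "(LINT x|lborel. carre_du_champ \<alpha> u u x * (W x)\<^sup>2) =
      (LINT x|lborel. ?K * ((u x * abs_D \<alpha> u x) * (W x)\<^sup>2) - 1 / 2 * ((W x)\<^sup>2 * singular_frac \<alpha> (\<lambda>x. u x * u x) x))"
  proof (intro Bochner_Integration.integral_cong refl)
    fix x
    have eq: "carre_du_champ \<alpha> u u x = ?K * (u x * abs_D \<alpha> u x) - 1 / 2 * singular_frac \<alpha> (\<lambda>x. u x * u x) x"
      using singular_frac_mult[OF \<alpha> u2 u2, of x]
      by (simp add: abs_D_eq_singular_frac[OF u \<alpha>, symmetric] algebra_simps)
    show "carre_du_champ \<alpha> u u x * (W x)\<^sup>2 = ?K * ((u x * abs_D \<alpha> u x) * (W x)\<^sup>2) -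
        1 / 2 * ((W x)\<^sup>2 * singular_frac \<alpha> (\<lambda>x. u x * u x) x)"
      unfolding eq by (simp add: algebra_simps)
  qed
  also have "\<dots> = (LINT x|lborel. ?K * ((u x * abs_D \<alpha> u x) * (W x)\<^sup>2)) -
      1 / 2 * (LINT x|lborel. (W x)\<^sup>2 * singular_frac \<alpha> (\<lambda>x. u x * u x) x)"
    using I1 I3 by simp
  also have "(LINT x|lborel. (W x)\<^sup>2 * singular_frac \<alpha> (\<lambda>x. u x * u x) x) =
      (LINT x|lborel. u x * u x * singular_frac \<alpha> (\<lambda>x. (W x)\<^sup>2) x)"
    by (rule singular_frac_symmetric[OF \<alpha> derivs_within_mono[OF derivs_within_unweighted[OF uu]] Iu WWd IW])
      simp
  also have "(LINT x|lborel. ?K * ((u x * abs_D \<alpha> u x) * (W x)\<^sup>2)) -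
      1 / 2 * (LINT x|lborel. u x * u x * singular_frac \<alpha> (\<lambda>x. (W x)\<^sup>2) x) =
      (LINT x|lborel. ?K * ((u x * abs_D \<alpha> u x) * (W x)\<^sup>2) -
        1 / 2 * (u x * u x * singular_frac \<alpha> (\<lambda>x. (W x)\<^sup>2) x))"
    using I1 I2 by simp
  also have "\<dots> \<le> (LINT x|lborel. (?K + L + E) * ?S x)"
  proof (rule integral_mono)
    fix x
    have "u x * abs_D \<alpha> u x \<le> (u x)\<^sup>2 + (abs_D \<alpha> u x)\<^sup>2"
      using zero_le_power2[of "u x - abs_D \<alpha> u x"] zero_le_power2[of "u x"] zero_le_power2[of "abs_D \<alpha> u x"]
      unfolding power2_diff by linarith
    then have 1: "?K * ((u x * abs_D \<alpha> u x) * (W x)\<^sup>2) \<le> ?K * ?S x"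
      using K by (intro mult_left_mono mult_right_mono) auto
    have "u x * u x * (- singular_frac \<alpha> (\<lambda>x. (W x)\<^sup>2) x) \<le> (u x * u x) * (2 * (L + E) * (W x)\<^sup>2)"
      using LWW[of x] by (intro mult_left_mono) auto
    also have "\<dots> \<le> 2 * ((L + E) * ?S x)" using uS[of x] by (simp only: mult.assoc)
    finally show "?K * ((u x * abs_D \<alpha> u x) * (W x)\<^sup>2) -
        1 / 2 * (u x * u x * singular_frac \<alpha> (\<lambda>x. (W x)\<^sup>2) x) \<le> (?K + L + E) * ?S x"
      using 1 unfolding add.assoc distrib_right[of ?K] by linarith
  qed (use S I1 I2 in auto)
  also have "\<dots> = (?K + L + E) * (LINT x|lborel. ?S x)" by simp
  finally show ?thesis .
qed

text \<open>The two integrals on the left may be subtracted under the integral sign because the pointwise bound makes the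
commutator term integrable; the energy bound then absorbs \<open>\<Gamma>(u, u)\<close>.\<close>

lemma weighted_commutator_estimate:
  fixes \<alpha> :: real
  assumes \<alpha>: "0 < \<alpha>" "\<alpha> < 2"
  shows "\<exists>C>0. \<forall>u A. derivs_within (\<lambda>x. inverse (1 + x\<^sup>2)) 4 u \<longrightarrow> A > 1 \<longrightarrow>
    \<bar>(LINT x|lborel. abs_D \<alpha> (\<lambda>y. u y * weight \<alpha> (y / A)) x * (abs_D \<alpha> u x * weight \<alpha> (x / A)))
      - (LINT x|lborel. (abs_D \<alpha> u x)\<^sup>2 * (weight \<alpha> (x / A))\<^sup>2)\<bar>
    \<le> C / A powr (\<alpha> / 2)
      * (LINT x|lborel. ((u x)\<^sup>2 + (abs_D (\<alpha> / 2) u x)\<^sup>2 + (abs_D \<alpha> u x)\<^sup>2) * (weight \<alpha> (x / A))\<^sup>2)"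
proof -
  let ?K = "symbol_const \<alpha>"
  obtain E where E: "E \<ge> 0" "\<And>x. carre_du_champ \<alpha> (weight \<alpha>) (weight \<alpha>) x \<le> E * (weight \<alpha> x)\<^sup>2"
    using weight_carre_bound[OF \<alpha>] by blast
  obtain L where L: "L \<ge> 0" "\<And>x. \<bar>singular_frac \<alpha> (weight \<alpha>) x\<bar> \<le> L * weight \<alpha> x"
    using weight_singular_frac_bound[OF \<alpha>] by blast
  have K: "?K > 0" by (rule symbol_const_pos[OF \<alpha>])
  let ?M = "2 * (L + E) + ?K"
  let ?C = "?M / ?K"
  have "\<bar>(LINT x|lborel. abs_D \<alpha> (\<lambda>y. u y * weight \<alpha> (y / A)) x * (abs_D \<alpha> u x * weight \<alpha> (x / A)))
      - (LINT x|lborel. (abs_D \<alpha> u x)\<^sup>2 * (weight \<alpha> (x / A))\<^sup>2)\<bar>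
    \<le> ?C / A powr (\<alpha> / 2)
      * (LINT x|lborel. ((u x)\<^sup>2 + (abs_D (\<alpha> / 2) u x)\<^sup>2 + (abs_D \<alpha> u x)\<^sup>2) * (weight \<alpha> (x / A))\<^sup>2)"
    if u: "derivs_within (\<lambda>x. inverse (1 + x\<^sup>2)) 4 u" and A: "A > 1" for u A
  proof -
    define W where "W x = weight \<alpha> (x / A)" for x
    let ?p = "abs_D \<alpha> u"
    let ?X = "\<lambda>x. (abs_D \<alpha> (\<lambda>y. u y * W y) x - ?p x * W x) * (?p x * W x)"
    let ?S = "\<lambda>x. ((u x)\<^sup>2 + (?p x)\<^sup>2) * (W x)\<^sup>2"
    let ?R = "\<lambda>x. ((u x)\<^sup>2 + (abs_D (\<alpha> / 2) u x)\<^sup>2 + (?p x)\<^sup>2) * (W x)\<^sup>2"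
    have A0: "A > 0" using A by simp
    have u4: "derivs_within (\<lambda>_. 1) 4 u" using u by (rule derivs_within_unweighted)
    have u1: "derivs_within (\<lambda>_. 1) 1 u"
      using u4 by (rule derivs_within_mono) simp
    note [measurable] = derivs_within_measurable[OF u]
    have [measurable]: "W \<in> borel_measurable borel" unfolding W_def by measurable
    have [measurable]: "carre_du_champ \<alpha> u u \<in> borel_measurable borel"
      unfolding carre_du_champ_def[abs_def] by measurable
    obtain B where B: "\<And>x. \<bar>u x\<bar> \<le> B" using derivs_within_bound[OF u4] by auto
    obtain P where P: "\<And>x. \<bar>?p x\<bar> \<le> P" using abs_D_bounded[OF u, of \<alpha>] \<alpha> by auto
    obtain H where H: "\<And>x. \<bar>abs_D (\<alpha> / 2) u x\<bar> \<le> H" using abs_D_bounded[OF u, of "\<alpha> / 2"] \<alpha> by auto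
    obtain G where G: "\<And>x. carre_du_champ \<alpha> u u x \<le> G" using carre_bounded[OF \<alpha> u1] by auto
    have sq: "t\<^sup>2 \<le> b\<^sup>2" if "\<bar>t\<bar> \<le> b" for t b :: real
      using power_mono[OF that abs_ge_zero, of 2] by simp
    have S: "integrable lborel ?S"
      unfolding W_def
      by (rule integrable_bounded_times_weight[OF \<alpha> A0, of _ "B\<^sup>2 + P\<^sup>2"]) (auto intro!: add_mono sq B P)
    have R: "integrable lborel ?R"
      unfolding W_def
      by (rule integrable_bounded_times_weight[OF \<alpha> A0, of _ "B\<^sup>2 + H\<^sup>2 + P\<^sup>2"]) (auto intro!: add_mono sq B P H)
    have Q: "integrable lborel (\<lambda>x. (?p x)\<^sup>2 * (W x)\<^sup>2)"
      unfolding W_def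
      by (rule integrable_bounded_times_weight[OF \<alpha> A0, of _ "P\<^sup>2"]) (auto intro!: sq P)
    have Gi: "integrable lborel (\<lambda>x. carre_du_champ \<alpha> u u x * (W x)\<^sup>2)"
      unfolding W_def
      by (rule integrable_bounded_times_weight[OF \<alpha> A0, of _ G]) (auto simp: G carre_nonneg[OF \<alpha>])
    let ?Y = "\<lambda>x. A powr (- (\<alpha> / 2)) / ?K * ((L + E) * ?S x + carre_du_champ \<alpha> u u x * (W x)\<^sup>2)"
    have Y: "integrable lborel ?Y" using S Gi by simp
    have XY: "\<bar>?X x\<bar> \<le> ?Y x" for x
      using commutator_pointwise_bound[OF \<alpha> A u E(2,1) L(2,1), of x] K
      unfolding W_def by (simp add: field_simps)
    have "norm (?X x) \<le> norm (?Y x)" for x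
      unfolding real_norm_def by (rule order_trans[OF XY abs_ge_self])
    then have X: "integrable lborel ?X"
      by (intro Bochner_Integration.integrable_bound[OF Y] AE_I2) measurable
    have "(LINT x|lborel. abs_D \<alpha> (\<lambda>y. u y * W y) x * (?p x * W x)) =
        (LINT x|lborel. ?X x + (?p x)\<^sup>2 * (W x)\<^sup>2)"
      by (intro Bochner_Integration.integral_cong refl) (simp add: power2_eq_square algebra_simps)
    then have "\<bar>(LINT x|lborel. abs_D \<alpha> (\<lambda>y. u y * W y) x * (?p x * W x)) - (LINT x|lborel. (?p x)\<^sup>2 * (W x)\<^sup>2)\<bar> =
        \<bar>LINT x|lborel. ?X x\<bar>"
      using X Q by simp
    also have "\<dots> \<le> (LINT x|lborel. ?Y x)"
      using Bochner_Integration.integral_norm_bound_integral[OF X Y] XY by simp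
    also have "\<dots> = A powr (- (\<alpha> / 2)) / ?K *
        ((L + E) * (LINT x|lborel. ?S x) + (LINT x|lborel. carre_du_champ \<alpha> u u x * (W x)\<^sup>2))"
      using S Gi by simp
    also have "\<dots> \<le> A powr (- (\<alpha> / 2)) / ?K *
        ((L + E) * (LINT x|lborel. ?S x) + (?K + L + E) * (LINT x|lborel. ?S x))"
      using carre_energy_bound[OF \<alpha> A u E(2,1) L(2,1)] K
      unfolding W_def by (intro mult_left_mono add_left_mono) auto
    also have "\<dots> = A powr (- (\<alpha> / 2)) / ?K * (?M * (LINT x|lborel. ?S x))"
      by (simp add: algebra_simps)
    also have "\<dots> \<le> A powr (- (\<alpha> / 2)) / ?K * (?M * (LINT x|lborel. ?R x))"
      using K E(1) L(1) by (intro mult_left_mono integral_mono S R mult_right_mono) auto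
    also have "\<dots> = ?C / A powr (\<alpha> / 2) * (LINT x|lborel. ?R x)"
      unfolding powr_minus divide_inverse by (simp only: mult_ac)
    finally show ?thesis unfolding W_def .
  qed
  moreover have "?C > 0" using K E(1) L(1) by (simp add: add_nonneg_pos)
  ultimately show ?thesis by blast
qed

section \<open>The profile and its square-root derivative\<close>

lemma japanese_bracket_weight: "1 / japanese_bracket s powr (1 + \<alpha>) = (weight \<alpha> s)\<^sup>2"
proof -
  have "japanese_bracket s powr (1 + \<alpha>) = (1 + s\<^sup>2) powr ((1 + \<alpha>) / 2)"
    by (simp add: japanese_bracket_def powr_powr)
  then show ?thesis
    by (simp add: weight_square powr_minus_divide[symmetric] minus_divide_left)
qed

text \<open>The fundamental theorem of calculus is applied to the integral over \<open>[y - 1, t]\<close> for \<open>t\<close> near \<open>y\<close>; any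
left end point below \<open>y\<close> would do.\<close>

lemma phi_has_derivative:
  assumes \<alpha>: "0 < \<alpha>" "\<alpha> < 2"
  shows "(phi \<alpha> has_real_derivative - inverse (LINT s|lborel. (weight \<alpha> s)\<^sup>2) * (weight \<alpha> y)\<^sup>2) (at y)"
proof -
  let ?g = "\<lambda>s. (weight \<alpha> s)\<^sup>2"
  have gi: "integrable lborel ?g" by (rule weight_square_integrable[OF \<alpha>])
  have cont: "continuous_on UNIV ?g"
    using derivs_within_continuous[OF weight_derivs_within[OF \<alpha>(1), of 0]] by (intro continuous_intros)
  have si: "set_integrable lborel S ?g" if "S \<in> sets borel" for S
    using integrable_mult_indicator[OF _ gi, of S] that by (simp add: set_integrable_def)
  have tail: "(LINT s:{t..}|lborel. ?g s) = (LINT s:{y - 1<..}|lborel. ?g s) - (LBINT s=ereal (y - 1)..ereal t. ?g s)"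
    if "t \<in> {y - 1<..<y + 1}" for t
  proof -
    have "{y - 1<..} = {y - 1<..<t} \<union> {t..}" "{y - 1<..<t} \<inter> {t..} = {}" using that by auto
    then have "(LINT s:{y - 1<..}|lborel. ?g s) = (LINT s:{y - 1<..<t}|lborel. ?g s) + (LINT s:{t..}|lborel. ?g s)"
      by (metis set_integral_Un si borel_open borel_closed open_greaterThanLessThan closed_atLeast)
    then show ?thesis using that by (simp add: interval_lebesgue_integral_def)
  qed
  have "((\<lambda>t. LBINT s=ereal (y - 1)..ereal t. ?g s) has_vector_derivative ?g y) (at y within {y - 1..y + 1})"
    by (rule interval_integral_FTC2) (use continuous_on_subset[OF cont] in auto)
  then have "((\<lambda>t. LBINT s=ereal (y - 1)..ereal t. ?g s) has_real_derivative ?g y) (at y)"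
    by (simp add: has_real_derivative_iff_has_vector_derivative at_within_Icc_at)
  then have "((\<lambda>t. (LINT s:{y - 1<..}|lborel. ?g s) - (LBINT s=ereal (y - 1)..ereal t. ?g s))
      has_real_derivative 0 - ?g y) (at y)"
    by (intro DERIV_diff DERIV_const)
  then have "((\<lambda>t. LINT s:{t..}|lborel. ?g s) has_real_derivative 0 - ?g y) (at y)"
    by (rule has_field_derivative_transform_within_open[of _ _ _ "{y - 1<..<y + 1}"]) (use tail in auto)
  from DERIV_cmult[OF this, of "inverse (LINT s|lborel. ?g s)"]
  show ?thesis unfolding phi_def[abs_def] japanese_bracket_weight by simp
qed

text \<open>Both profiles have the form \<open>a (1 - \<phi>) + b \<phi>\<close>, with derivative \<open>(b - a) \<phi>'\<close>; only the constant \<open>c\<close>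
depends on \<open>j\<close>, \<open>\<mu>1\<close> and \<open>\<mu>2\<close>.\<close>

lemma PhiA_weight:
  assumes \<alpha>: "0 < \<alpha>" "\<alpha> < 2"
  shows "\<exists>c. \<forall>A x. PhiA \<alpha> \<mu>1 \<mu>2 j A x = c * weight \<alpha> (x / A)"
proof -
  have *: "\<exists>c. \<forall>y. sqrt \<bar>deriv f y\<bar> = c * weight \<alpha> y"
    if f: "f = (\<lambda>y. a * (1 - phi \<alpha> y) + b * phi \<alpha> y)" for f a b
  proof -
    let ?I = "inverse (LINT s|lborel. (weight \<alpha> s)\<^sup>2)"
    have "sqrt \<bar>deriv f y\<bar> = sqrt \<bar>(b - a) * ?I\<bar> * weight \<alpha> y" for y
    proof -
      have "(f has_real_derivative a * (0 - - ?I * (weight \<alpha> y)\<^sup>2) + b * (- ?I * (weight \<alpha> y)\<^sup>2)) (at y)"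
        unfolding f by (intro DERIV_add DERIV_cmult DERIV_diff DERIV_const phi_has_derivative \<alpha>)
      then have "deriv f y = - ((b - a) * ?I) * (weight \<alpha> y)\<^sup>2"
        by (simp add: DERIV_imp_deriv algebra_simps)
      then show ?thesis by (simp add: abs_mult real_sqrt_mult less_imp_le)
    qed
    then show ?thesis by blast
  qed
  have "phi1 \<alpha> \<mu>1 \<mu>2 = (\<lambda>y. (1 / (1 + \<mu>1)\<^sup>2) * (1 - phi \<alpha> y) + (1 / (1 + \<mu>2)\<^sup>2) * phi \<alpha> y)"
    "phi2 \<alpha> \<mu>1 \<mu>2 = (\<lambda>y. (\<mu>1 / (1 + \<mu>1)\<^sup>2) * (1 - phi \<alpha> y) + (\<mu>2 / (1 + \<mu>2)\<^sup>2) * phi \<alpha> y)"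
    by (auto simp: phi1_def phi2_def)
  from *[OF this(1)] *[OF this(2)] show ?thesis
    unfolding PhiA_def Phi_def by (cases "j = 1") fastforce+
qed

theorem lemma27:
  fixes \<alpha> :: real
  assumes "0 < \<alpha>" and "\<alpha> < 2"
  shows "\<exists>C>0. \<forall>\<mu>1 > -1. \<forall>\<mu>2 > -1. \<forall>u. schwartz u \<longrightarrow> (\<forall>A>1. \<forall>j\<in>{1, 2}.
    \<bar>(LINT x|lborel. abs_D \<alpha> (\<lambda>y. u y * PhiA \<alpha> \<mu>1 \<mu>2 j A y) x
                       * (abs_D \<alpha> u x * PhiA \<alpha> \<mu>1 \<mu>2 j A x))
      - (LINT x|lborel. (abs_D \<alpha> u x)\<^sup>2 * (PhiA \<alpha> \<mu>1 \<mu>2 j A x)\<^sup>2)\<bar>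
    \<le> C / A powr (\<alpha> / 2)
      * (LINT x|lborel. ((u x)\<^sup>2 + (abs_D (\<alpha> / 2) u x)\<^sup>2 + (abs_D \<alpha> u x)\<^sup>2)
                          * (PhiA \<alpha> \<mu>1 \<mu>2 j A x)\<^sup>2))"
proof -
  obtain C where "C > 0" and C: "\<And>u A. derivs_within (\<lambda>x. inverse (1 + x\<^sup>2)) 4 u \<Longrightarrow> A > 1 \<Longrightarrow>
    \<bar>(LINT x|lborel. abs_D \<alpha> (\<lambda>y. u y * weight \<alpha> (y / A)) x * (abs_D \<alpha> u x * weight \<alpha> (x / A)))
      - (LINT x|lborel. (abs_D \<alpha> u x)\<^sup>2 * (weight \<alpha> (x / A))\<^sup>2)\<bar>
    \<le> C / A powr (\<alpha> / 2)
      * (LINT x|lborel. ((u x)\<^sup>2 + (abs_D (\<alpha> / 2) u x)\<^sup>2 + (abs_D \<alpha> u x)\<^sup>2) * (weight \<alpha> (x / A))\<^sup>2)"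
    using weighted_commutator_estimate[OF assms] by blast
  show ?thesis
  proof (intro exI[of _ C] conjI allI impI ballI \<open>C > 0\<close>)
    fix \<mu>1 \<mu>2 A :: real and u :: "real \<Rightarrow> real" and j :: nat
    assume "schwartz u" and A: "A > 1"
    then have u: "derivs_within (\<lambda>x. inverse (1 + x\<^sup>2)) 4 u"
      using schwartz_derivs_within[of u 4 0] by simp
    obtain c where c: "\<And>A x. PhiA \<alpha> \<mu>1 \<mu>2 j A x = c * weight \<alpha> (x / A)"
      using PhiA_weight[OF assms] by blast
    let ?w = "\<lambda>x. weight \<alpha> (x / A)" and ?p = "abs_D \<alpha> u"
    let ?R = "\<lambda>x. (u x)\<^sup>2 + (abs_D (\<alpha> / 2) u x)\<^sup>2 + (?p x)\<^sup>2"
    have 1: "abs_D \<alpha> (\<lambda>y. u y * (c * ?w y)) x * (?p x * (c * ?w x)) =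
        c\<^sup>2 * (abs_D \<alpha> (\<lambda>y. u y * ?w y) x * (?p x * ?w x))" for x
      using abs_D_cmult[of \<alpha> c "\<lambda>y. u y * ?w y" x] by (simp add: mult_ac power2_eq_square)
    have 2: "t * (c * s)\<^sup>2 = c\<^sup>2 * (t * s\<^sup>2)" for t s :: real by (simp add: power_mult_distrib)
    have "\<bar>c\<^sup>2 * (LINT x|lborel. abs_D \<alpha> (\<lambda>y. u y * ?w y) x * (?p x * ?w x))
        - c\<^sup>2 * (LINT x|lborel. (?p x)\<^sup>2 * (?w x)\<^sup>2)\<bar> =
      c\<^sup>2 * \<bar>(LINT x|lborel. abs_D \<alpha> (\<lambda>y. u y * ?w y) x * (?p x * ?w x))
        - (LINT x|lborel. (?p x)\<^sup>2 * (?w x)\<^sup>2)\<bar>"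
      by (simp add: abs_mult flip: right_diff_distrib)
    also have "\<dots> \<le> c\<^sup>2 * (C / A powr (\<alpha> / 2) * (LINT x|lborel. ?R x * (?w x)\<^sup>2))"
      by (intro mult_left_mono C u A) simp
    also have "\<dots> = C / A powr (\<alpha> / 2) * (c\<^sup>2 * (LINT x|lborel. ?R x * (?w x)\<^sup>2))" by simp
    finally show "\<bar>(LINT x|lborel. abs_D \<alpha> (\<lambda>y. u y * PhiA \<alpha> \<mu>1 \<mu>2 j A y) x
                       * (abs_D \<alpha> u x * PhiA \<alpha> \<mu>1 \<mu>2 j A x))
      - (LINT x|lborel. (abs_D \<alpha> u x)\<^sup>2 * (PhiA \<alpha> \<mu>1 \<mu>2 j A x)\<^sup>2)\<bar>
    \<le> C / A powr (\<alpha> / 2)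
      * (LINT x|lborel. ((u x)\<^sup>2 + (abs_D (\<alpha> / 2) u x)\<^sup>2 + (abs_D \<alpha> u x)\<^sup>2)
                          * (PhiA \<alpha> \<mu>1 \<mu>2 j A x)\<^sup>2)"
      unfolding c 1 2 integral_mult_right_zero .
  qed
qed

end
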